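(* Let $A$ be a $C^*$-algebra, $G$ a locally compact group with a regular Borel measure $\mu$, and $\alpha$ a norm continuous action ("one-parameter group") of $G$ on $A$. Let $f:G\to\mathbb C$ be a continuous $\mu$-integrable function, $(a_i)_{i\in I}$ a bounded net in $M(A)$ and $a\in M(A)$ such that $(a_i)_{i\in I}$ converges strictly to $a$. Then $\bigl(\int f(t)\,\alpha_t(a_i)\,d\mu(t)\bigr)_{i\in I}$ is a bounded net in $M(A)$ which converges strictly to $\int f(t)\,\alpha_t(a)\,d\mu(t)$.
   Context: $M(A)$ is the multiplier algebra of $A$. A norm continuous one-parameter group of $G$ on $A$ is a group homomorphism $t\mapsto\alpha_t$ from $G$ to the group $\operatorname{Aut}(A)$ of $*$-automorphisms such that for all $a\in A$ the function $G\to A:t\mapsto\alpha_t(a)$ is norm continuous. Each $\alpha_t$ is extended to $M(A)$ by strict continuity; then $t\mapsto\alpha_t(a)$ is strictly continuous for $a\in M(A)$. If $X$ is a locally compact space with regular Borel measure $\mu$ and $h:X\to M(A)$ is strictly continuous with $\|h(t)\|\le g(t)$ for some $\mu$-integrable $g:X\to\mathbb R^+$, then $\int h(t)\,d\mu(t)$ denotes the unique element of $M(A)$ such that $\bigl(\int h(t)\,d\mu(t)\bigr)b=\int h(t)b\,d\mu(t)$ and $b\bigl(\int h(t)\,d\mu(t)\bigr)=\int b\,h(t)\,d\mu(t)$ for all $b\in A$, the right-hand sides being integrals of norm continuous dominated $A$-valued functions. *)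

theory Defs
  imports "HOL-Analysis.Analysis"
begin

section \<open>C*-algebras\<close>

text \<open>No unit is required. The real structure inherited from \<^class>\<open>banach\<close> is tied to the
  complex one by \<open>scaleR_scaleC\<close>.\<close>

class cstar_algebra = real_normed_algebra + banach +
  fixes scaleC :: "complex \<Rightarrow> 'a \<Rightarrow> 'a" (infixr \<open>*\<^sub>C\<close> 75)
    and star :: "'a \<Rightarrow> 'a"
  assumes scaleC_add_right: "c *\<^sub>C (x + y) = c *\<^sub>C x + c *\<^sub>C y"
    and scaleC_add_left: "(c + d) *\<^sub>C x = c *\<^sub>C x + d *\<^sub>C x"
    and scaleC_scaleC: "c *\<^sub>C d *\<^sub>C x = (c * d) *\<^sub>C x"
    and scaleR_scaleC: "r *\<^sub>R x = complex_of_real r *\<^sub>C x"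
    and norm_scaleC: "norm (c *\<^sub>C x) = cmod c * norm x"
    and mult_scaleC_left: "(c *\<^sub>C x) * y = c *\<^sub>C (x * y)"
    and mult_scaleC_right: "x * (c *\<^sub>C y) = c *\<^sub>C (x * y)"
    and star_star: "star (star x) = x"
    and star_add: "star (x + y) = star x + star y"
    and star_scaleC: "star (c *\<^sub>C x) = cnj c *\<^sub>C star x"
    and star_mult: "star (x * y) = star y * star x"
    and cstar_identity: "norm (star x * x) = (norm x)\<^sup>2"
lemma star_scaleR: "star (r *\<^sub>R x) = r *\<^sub>R star (x :: 'a::cstar_algebra)"
  by (simp add: scaleR_scaleC star_scaleC)

lemma scaleC_scaleR: "c *\<^sub>C (r *\<^sub>R x) = r *\<^sub>R (c *\<^sub>C (x :: 'a::cstar_algebra))"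
  by (simp add: scaleR_scaleC scaleC_scaleC mult.commute)

lemma star_zero: "star (0 :: 'a::cstar_algebra) = 0"
  using star_scaleR[of 0 "0 :: 'a"] by simp

lemma norm_le_norm_star: "norm x \<le> norm (star (x :: 'a::cstar_algebra))"
proof (cases "norm x = 0")
  case False
  have "norm x * norm x \<le> norm (star x) * norm x"
    using cstar_identity[of x] norm_mult_ineq[of "star x" x] by (simp add: power2_eq_square)
  with False show ?thesis
    by (metis mult_right_le_imp_le norm_ge_zero order_le_less)
qed simp

lemma norm_star: "norm (star x) = norm (x :: 'a::cstar_algebra)"
  using norm_le_norm_star[of x] norm_le_norm_star[of "star x"] by (simp add: star_star)

lemma scaleC_zero: "c *\<^sub>C (0 :: 'a::cstar_algebra) = 0"
  by (metis norm_eq_zero norm_scaleC mult_zero_right norm_zero)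

lemma scaleC_one: "1 *\<^sub>C (x :: 'a::cstar_algebra) = x"
  by (metis of_real_1 scaleR_one scaleR_scaleC)

lemma scaleC_minus_one: "(- 1) *\<^sub>C (x :: 'a::cstar_algebra) = - x"
  by (metis of_real_1 of_real_minus scaleR_minus1_left scaleR_scaleC)

lemma bounded_linear_star: "bounded_linear (star :: 'a::cstar_algebra \<Rightarrow> 'a)"
  by (rule bounded_linear_intro[of _ 1]) (auto simp: star_add star_scaleR norm_star)

lemma bounded_linear_scaleC: "bounded_linear ((*\<^sub>C) c :: 'a::cstar_algebra \<Rightarrow> 'a)"
  by (rule bounded_linear_intro[of _ "cmod c"])
    (auto simp: scaleC_add_right scaleC_scaleR norm_scaleC)

lemma right_factor_cong_cstar:
  fixes x y :: "'a::cstar_algebra"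
  assumes "\<And>c. c * x = c * y"
  shows "x = y"
proof -
  have "star (x - y) * (x - y) = 0" using assms by (simp add: right_diff_distrib)
  then show ?thesis using cstar_identity[of "x - y"] by simp
qed

lemma left_factor_cong_cstar:
  fixes x y :: "'a::cstar_algebra"
  assumes "\<And>c. x * c = y * c"
  shows "x = y"
proof -
  have "star x = star y"
    by (rule right_factor_cong_cstar) (metis assms star_mult star_star)
  then show ?thesis by (metis star_star)
qed

section \<open>The multiplier algebra\<close>

text \<open>Double centralizers: a multiplier \<open>m\<close> is the pair of the bounded linear maps
  \<open>b \<mapsto> m b\<close> and \<open>b \<mapsto> b m\<close>.\<close>

definition double_centralizer ::
  "('a::cstar_algebra \<Rightarrow>\<^sub>L 'a) \<times> ('a \<Rightarrow>\<^sub>L 'a) \<Rightarrow> bool" where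
  "double_centralizer = (\<lambda>(L, R).
     (\<forall>c b. blinfun_apply L (c *\<^sub>C b) = c *\<^sub>C blinfun_apply L b) \<and>
     (\<forall>c b. blinfun_apply R (c *\<^sub>C b) = c *\<^sub>C blinfun_apply R b) \<and>
     (\<forall>a b. blinfun_apply L (a * b) = blinfun_apply L a * b) \<and>
     (\<forall>a b. blinfun_apply R (a * b) = a * blinfun_apply R b) \<and>
     (\<forall>a b. blinfun_apply R a * b = a * blinfun_apply L b))"

typedef (overloaded) 'a multiplier =
  "{p :: ('a::cstar_algebra \<Rightarrow>\<^sub>L 'a) \<times> ('a \<Rightarrow>\<^sub>L 'a). double_centralizer p}"
  by (rule exI[of _ 0]) (simp add: double_centralizer_def zero_prod_def
      scaleC_add_right[of _ 0 0, simplified])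

definition mult_left :: "'a::cstar_algebra multiplier \<Rightarrow> 'a \<Rightarrow> 'a" (infixl \<open>\<cdot>\<^sub>L\<close> 70) where
  "m \<cdot>\<^sub>L b = blinfun_apply (fst (Rep_multiplier m)) b"

definition mult_right :: "'a \<Rightarrow> 'a::cstar_algebra multiplier \<Rightarrow> 'a" (infixl \<open>\<cdot>\<^sub>R\<close> 70) where
  "b \<cdot>\<^sub>R m = blinfun_apply (snd (Rep_multiplier m)) b"

lemma bounded_linear_multiplier_left: "bounded_linear ((\<cdot>\<^sub>L) m)"
  unfolding mult_left_def[abs_def] by (rule blinfun.bounded_linear_right)

lemma bounded_linear_multiplier_right: "bounded_linear (\<lambda>b. b \<cdot>\<^sub>R m)"
  unfolding mult_right_def[abs_def] by (rule blinfun.bounded_linear_right)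

lemma multiplier_rules:
  shows mult_left_scaleC: "m \<cdot>\<^sub>L (c *\<^sub>C b) = c *\<^sub>C (m \<cdot>\<^sub>L b)"
    and mult_right_scaleC: "(c *\<^sub>C b) \<cdot>\<^sub>R m = c *\<^sub>C (b \<cdot>\<^sub>R m)"
    and mult_left_mult: "m \<cdot>\<^sub>L (a * b) = (m \<cdot>\<^sub>L a) * b"
    and mult_right_mult: "(a * b) \<cdot>\<^sub>R m = a * (b \<cdot>\<^sub>R m)"
    and mult_right_left: "(a \<cdot>\<^sub>R m) * b = a * (m \<cdot>\<^sub>L b)"
  using Rep_multiplier[of m]
  by (auto simp: double_centralizer_def mult_left_def mult_right_def split: prod.splits)

lemma multiplier_eqI:
  assumes "\<And>b. m \<cdot>\<^sub>L b = n \<cdot>\<^sub>L b"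
  shows "m = n"
proof -
  have "b \<cdot>\<^sub>R m = b \<cdot>\<^sub>R n" for b
    by (rule left_factor_cong_cstar) (simp add: mult_right_left assms)
  with assms have "Rep_multiplier m = Rep_multiplier n"
    by (auto simp: mult_left_def mult_right_def prod_eq_iff blinfun_eqI)
  then show ?thesis by (simp add: Rep_multiplier_inject)
qed

definition make_multiplier ::
  "('a::cstar_algebra \<Rightarrow> 'a) \<Rightarrow> ('a \<Rightarrow> 'a) \<Rightarrow> 'a multiplier" where
  "make_multiplier L R = Abs_multiplier (Blinfun L, Blinfun R)"

lemma make_multiplier:
  assumes L: "bounded_linear L" and R: "bounded_linear R"
    and "\<And>c b. L (c *\<^sub>C b) = c *\<^sub>C L b" "\<And>c b. R (c *\<^sub>C b) = c *\<^sub>C R b"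
    and "\<And>a b. L (a * b) = L a * b" "\<And>a b. R (a * b) = a * R b"
    and "\<And>a b. R a * b = a * L b"
  shows "make_multiplier L R \<cdot>\<^sub>L b = L b" "b \<cdot>\<^sub>R make_multiplier L R = R b"
proof -
  have "double_centralizer (Blinfun L, Blinfun R)"
    using assms by (simp add: double_centralizer_def bounded_linear_Blinfun_apply)
  then show "make_multiplier L R \<cdot>\<^sub>L b = L b" "b \<cdot>\<^sub>R make_multiplier L R = R b"
    using L R by (simp_all add: make_multiplier_def mult_left_def mult_right_def
        Abs_multiplier_inverse bounded_linear_Blinfun_apply)
qed

instantiation multiplier :: (cstar_algebra) real_normed_algebra
begin

definition "0 = make_multiplier (\<lambda>_. 0) (\<lambda>_. 0)"
definition "m + n = make_multiplier (\<lambda>b. m \<cdot>\<^sub>L b + n \<cdot>\<^sub>L b) (\<lambda>b. b \<cdot>\<^sub>R m + b \<cdot>\<^sub>R n)"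
definition "r *\<^sub>R m = make_multiplier (\<lambda>b. r *\<^sub>R (m \<cdot>\<^sub>L b)) (\<lambda>b. r *\<^sub>R (b \<cdot>\<^sub>R m))"
definition "- (m :: 'a multiplier) = (- 1) *\<^sub>R m"
definition "(m :: 'a multiplier) - n = m + - n"
definition "m * n = make_multiplier (\<lambda>b. m \<cdot>\<^sub>L (n \<cdot>\<^sub>L b)) (\<lambda>b. (b \<cdot>\<^sub>R m) \<cdot>\<^sub>R n)"
definition "norm m = onorm ((\<cdot>\<^sub>L) m)"
definition "sgn (m :: 'a multiplier) = inverse (norm m) *\<^sub>R m"
definition "dist (m :: 'a multiplier) n = norm (m - n)"
definition uniformity_multiplier_def:
  "(uniformity :: ('a multiplier \<times> 'a multiplier) filter) =
     (INF e\<in>{0<..}. principal {(m, n). dist m n < e})"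
definition open_multiplier_def:
  "open (U :: 'a multiplier set) \<longleftrightarrow> (\<forall>m\<in>U. \<forall>\<^sub>F (m', n) in uniformity. m' = m \<longrightarrow> n \<in> U)"

lemma multiplier_zero: "0 \<cdot>\<^sub>L b = (0::'a)" "b \<cdot>\<^sub>R 0 = (0::'a)"
  unfolding zero_multiplier_def
  by (subst make_multiplier; simp add: scaleC_zero)+

lemma multiplier_add:
  fixes m n :: "'a multiplier"
  shows "(m + n) \<cdot>\<^sub>L b = m \<cdot>\<^sub>L b + n \<cdot>\<^sub>L b" "b \<cdot>\<^sub>R (m + n) = b \<cdot>\<^sub>R m + b \<cdot>\<^sub>R n"
  unfolding plus_multiplier_def
  by (subst make_multiplier; simp add: multiplier_rules scaleC_add_right algebra_simps
      bounded_linear_add bounded_linear_multiplier_left bounded_linear_multiplier_right)+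

lemma multiplier_scaleR:
  fixes m :: "'a multiplier"
  shows "(r *\<^sub>R m) \<cdot>\<^sub>L b = r *\<^sub>R (m \<cdot>\<^sub>L b)" "b \<cdot>\<^sub>R (r *\<^sub>R m) = r *\<^sub>R (b \<cdot>\<^sub>R m)"
  unfolding scaleR_multiplier_def
  by (subst make_multiplier; simp add: multiplier_rules scaleC_scaleR
      bounded_linear_compose[OF bounded_linear_scaleR_right bounded_linear_multiplier_left]
      bounded_linear_compose[OF bounded_linear_scaleR_right bounded_linear_multiplier_right])+

lemma multiplier_uminus:
  fixes m :: "'a multiplier"
  shows "(- m) \<cdot>\<^sub>L b = - (m \<cdot>\<^sub>L b)" "b \<cdot>\<^sub>R (- m) = - (b \<cdot>\<^sub>R m)"
  by (simp_all add: uminus_multiplier_def multiplier_scaleR)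

lemma multiplier_diff:
  fixes m n :: "'a multiplier"
  shows "(m - n) \<cdot>\<^sub>L b = m \<cdot>\<^sub>L b - n \<cdot>\<^sub>L b" "b \<cdot>\<^sub>R (m - n) = b \<cdot>\<^sub>R m - b \<cdot>\<^sub>R n"
  by (simp_all add: minus_multiplier_def multiplier_add multiplier_uminus)

lemma multiplier_mult:
  fixes m n :: "'a multiplier"
  shows "(m * n) \<cdot>\<^sub>L b = m \<cdot>\<^sub>L (n \<cdot>\<^sub>L b)" "b \<cdot>\<^sub>R (m * n) = (b \<cdot>\<^sub>R m) \<cdot>\<^sub>R n"
  unfolding times_multiplier_def
  by (subst make_multiplier; simp add: multiplier_rules
      bounded_linear_compose[OF bounded_linear_multiplier_left bounded_linear_multiplier_left]
      bounded_linear_compose[OF bounded_linear_multiplier_right bounded_linear_multiplier_right])+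

lemma norm_multiplier_nonneg: "0 \<le> norm (m :: 'a multiplier)"
  unfolding norm_multiplier_def by (rule onorm_pos_le[OF bounded_linear_multiplier_left])

lemma norm_multiplier_left: "norm (m \<cdot>\<^sub>L b) \<le> norm m * norm (b :: 'a)"
  unfolding norm_multiplier_def by (rule onorm[OF bounded_linear_multiplier_left])

lemma norm_multiplier_le:
  fixes m :: "'a multiplier"
  assumes "0 \<le> C" "\<And>b. norm (m \<cdot>\<^sub>L b) \<le> C * norm b"
  shows "norm m \<le> C"
  unfolding norm_multiplier_def by (rule onorm_bound) (use assms in auto)

lemma norm_multiplier_right: "norm (b \<cdot>\<^sub>R m) \<le> norm m * norm (b :: 'a)"
proof (cases "norm (b \<cdot>\<^sub>R m) = 0")
  case True
  then show ?thesis by (metis mult_nonneg_nonneg norm_ge_zero norm_multiplier_nonneg)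
next
  case False
  let ?x = "b \<cdot>\<^sub>R m"
  have "(norm ?x)\<^sup>2 = norm (?x * star ?x)"
    using cstar_identity[of "star ?x"] by (simp add: star_star norm_star)
  also have "\<dots> \<le> norm b * norm (m \<cdot>\<^sub>L star ?x)"
    by (simp add: mult_right_left norm_mult_ineq)
  also have "\<dots> \<le> norm b * (norm m * norm ?x)"
    using norm_multiplier_left[of m "star ?x"] by (simp add: norm_star mult_left_mono)
  finally have "norm ?x * norm ?x \<le> (norm m * norm b) * norm ?x"
    by (simp add: power2_eq_square mult_ac)
  with False show ?thesis
    by (metis mult_right_le_imp_le norm_ge_zero order_le_less)
qed

instance
proof
  fix m n k :: "'a multiplier" and r s :: real
  note [simp] = multiplier_zero multiplier_add multiplier_scaleR
    multiplier_uminus multiplier_diff multiplier_mult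
  note lin = bounded_linear.linear[OF bounded_linear_multiplier_left]
  show "m + n + k = m + (n + k)" "m + n = n + m" "0 + m = m" "- m + m = 0" "m - n = m + - n"
    by (rule multiplier_eqI; simp)+
  show "r *\<^sub>R (m + n) = r *\<^sub>R m + r *\<^sub>R n" "(r + s) *\<^sub>R m = r *\<^sub>R m + s *\<^sub>R m"
    "r *\<^sub>R s *\<^sub>R m = (r * s) *\<^sub>R m" "1 *\<^sub>R m = m"
    by (rule multiplier_eqI; simp add: algebra_simps)+
  show "m * n * k = m * (n * k)" "(m + n) * k = m * k + n * k" "m * (n + k) = m * n + m * k"
    "r *\<^sub>R m * n = r *\<^sub>R (m * n)" "m * r *\<^sub>R n = r *\<^sub>R (m * n)"
    by (rule multiplier_eqI; simp add: linear_add[OF lin] linear_cmul[OF lin])+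
  show "dist m n = norm (m - n)" "sgn m = inverse (norm m) *\<^sub>R m"
    by (simp_all add: dist_multiplier_def sgn_multiplier_def)
  show "(uniformity :: ('a multiplier \<times> 'a multiplier) filter) =
      (INF e\<in>{0<..}. principal {(m, n). dist m n < e})"
    by (rule uniformity_multiplier_def)
  show "open U \<longleftrightarrow> (\<forall>m\<in>U. \<forall>\<^sub>F (m', n) in uniformity. m' = m \<longrightarrow> n \<in> U)"
    for U :: "'a multiplier set"
    by (rule open_multiplier_def)
  show "norm m = 0 \<longleftrightarrow> m = 0"
    using norm_multiplier_left[of m] by (auto intro!: multiplier_eqI simp: norm_multiplier_def onorm_eq_0
        bounded_linear_multiplier_left onorm_zero)
  show "norm (m + n) \<le> norm m + norm n"
    using norm_multiplier_left[of m] norm_multiplier_left[of n]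
    by (intro norm_multiplier_le)
      (auto simp: ring_distribs norm_multiplier_nonneg intro!: norm_triangle_mono)
  have "onorm (\<lambda>b. r *\<^sub>R (m \<cdot>\<^sub>L b)) = \<bar>r\<bar> * onorm ((\<cdot>\<^sub>L) m)"
    by (rule onorm_scaleR[OF bounded_linear_multiplier_left])
  moreover have "(\<cdot>\<^sub>L) (r *\<^sub>R m) = (\<lambda>b. r *\<^sub>R (m \<cdot>\<^sub>L b))" by auto
  ultimately show "norm (r *\<^sub>R m) = \<bar>r\<bar> * norm m"
    unfolding norm_multiplier_def by simp
  show "norm (m * n) \<le> norm m * norm n"
  proof (rule norm_multiplier_le)
    fix b
    have "norm (m \<cdot>\<^sub>L (n \<cdot>\<^sub>L b)) \<le> norm m * norm (n \<cdot>\<^sub>L b)" by (rule norm_multiplier_left)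
    also have "\<dots> \<le> norm m * (norm n * norm b)"
      by (intro mult_left_mono norm_multiplier_left norm_multiplier_nonneg)
    finally show "norm (m * n \<cdot>\<^sub>L b) \<le> norm m * norm n * norm b" by (simp add: mult.assoc)
  qed (simp add: norm_multiplier_nonneg)
qed

end

instance multiplier :: (cstar_algebra) banach
proof
  fix X :: "nat \<Rightarrow> 'a multiplier"
  assume X: "Cauchy X"
  define F where "F m = fst (Rep_multiplier m)" for m :: "'a multiplier"
  define S where "S m = snd (Rep_multiplier m)" for m :: "'a multiplier"
  have app: "blinfun_apply (F m) b = m \<cdot>\<^sub>L b" "blinfun_apply (S m) b = b \<cdot>\<^sub>R m" for m b
    by (simp_all add: F_def S_def mult_left_def mult_right_def)
  have diff: "F m - F n = F (m - n)" "S m - S n = S (m - n)" for m n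
    by (auto intro!: blinfun_eqI simp: blinfun.diff_left app multiplier_diff)
  have nF: "norm (F m) = norm m" for m
    by (simp add: norm_blinfun.rep_eq norm_multiplier_def app[abs_def])
  have nS: "norm (S m) \<le> norm m" for m
    by (rule norm_blinfun_bound) (auto simp: app norm_multiplier_right)
  have "Cauchy (\<lambda>n. F (X n))"
    using X by (simp add: Cauchy_def dist_norm diff nF)
  then obtain L where L: "(\<lambda>n. F (X n)) \<longlonglongrightarrow> L"
    by (auto simp: Cauchy_convergent_iff convergent_def)
  have "Cauchy (\<lambda>n. S (X n))"
    using X unfolding Cauchy_def dist_norm diff by (meson nS order_le_less_trans)
  then obtain R where R: "(\<lambda>n. S (X n)) \<longlonglongrightarrow> R"
    by (auto simp: Cauchy_convergent_iff convergent_def)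
  have l: "(\<lambda>n. X n \<cdot>\<^sub>L b) \<longlonglongrightarrow> blinfun_apply L b" for b
    using blinfun.tendsto[OF L tendsto_const[of b]] by (simp add: app)
  have r: "(\<lambda>n. b \<cdot>\<^sub>R X n) \<longlonglongrightarrow> blinfun_apply R b" for b
    using blinfun.tendsto[OF R tendsto_const[of b]] by (simp add: app)
  note scC = bounded_linear.tendsto[OF bounded_linear_scaleC]
  define m where "m = make_multiplier (blinfun_apply L) (blinfun_apply R)"
  have m: "m \<cdot>\<^sub>L b = blinfun_apply L b" for b
    unfolding m_def
  proof (rule make_multiplier(1))
    show "blinfun_apply L (c *\<^sub>C b) = c *\<^sub>C blinfun_apply L b" for c b
      using LIMSEQ_unique[OF l[of "c *\<^sub>C b"]] scC[OF l[of b], of c] by (simp add: mult_left_scaleC)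
    show "blinfun_apply R (c *\<^sub>C b) = c *\<^sub>C blinfun_apply R b" for c b
      using LIMSEQ_unique[OF r[of "c *\<^sub>C b"]] scC[OF r[of b], of c] by (simp add: mult_right_scaleC)
    show "blinfun_apply L (a * b) = blinfun_apply L a * b" for a b
      using LIMSEQ_unique[OF l[of "a * b"]] tendsto_mult_right[OF l[of a], of b]
      by (simp add: mult_left_mult)
    show "blinfun_apply R (a * b) = a * blinfun_apply R b" for a b
      using LIMSEQ_unique[OF r[of "a * b"]] tendsto_mult_left[OF r[of b], of a]
      by (simp add: mult_right_mult)
    show "blinfun_apply R a * b = a * blinfun_apply L b" for a b
      using LIMSEQ_unique[OF tendsto_mult_right[OF r[of a], of b]] tendsto_mult_left[OF l[of b], of a]
      by (simp add: mult_right_left)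
  qed (rule blinfun.bounded_linear_right)+
  have "F m = L" by (rule blinfun_eqI) (simp add: app m)
  then have "X \<longlonglongrightarrow> m"
    using L by (simp add: LIMSEQ_def dist_norm diff nF flip: \<open>F m = L\<close>)
  then show "convergent X" by (auto simp: convergent_def)
qed

instantiation multiplier :: (cstar_algebra) cstar_algebra
begin

definition "c *\<^sub>C m = make_multiplier (\<lambda>b. c *\<^sub>C (m \<cdot>\<^sub>L b)) (\<lambda>b. c *\<^sub>C (b \<cdot>\<^sub>R m))"
definition "star m = make_multiplier (\<lambda>b. star (star b \<cdot>\<^sub>R m)) (\<lambda>b. star (m \<cdot>\<^sub>L star b))"

lemma multiplier_scaleC:
  fixes m :: "'a multiplier"
  shows "(c *\<^sub>C m) \<cdot>\<^sub>L b = c *\<^sub>C (m \<cdot>\<^sub>L b)" "b \<cdot>\<^sub>R (c *\<^sub>C m) = c *\<^sub>C (b \<cdot>\<^sub>R m)"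
  unfolding scaleC_multiplier_def
  by (subst make_multiplier; simp add: multiplier_rules scaleC_scaleC mult.commute
      mult_scaleC_left mult_scaleC_right
      bounded_linear_compose[OF bounded_linear_scaleC bounded_linear_multiplier_left]
      bounded_linear_compose[OF bounded_linear_scaleC bounded_linear_multiplier_right])+

lemma multiplier_star:
  fixes m :: "'a multiplier"
  shows "star m \<cdot>\<^sub>L b = star (star b \<cdot>\<^sub>R m)" "b \<cdot>\<^sub>R star m = star (m \<cdot>\<^sub>L star b)"
proof -
  have adj: "star (m \<cdot>\<^sub>L star a) * b = a * star (star b \<cdot>\<^sub>R m)" for a b
    by (metis mult_right_left star_mult star_star)
  note * = bounded_linear_compose[OF bounded_linear_star
      bounded_linear_compose[OF bounded_linear_multiplier_right bounded_linear_star]]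
    bounded_linear_compose[OF bounded_linear_star
      bounded_linear_compose[OF bounded_linear_multiplier_left bounded_linear_star]]
  show "star m \<cdot>\<^sub>L b = star (star b \<cdot>\<^sub>R m)" "b \<cdot>\<^sub>R star m = star (m \<cdot>\<^sub>L star b)"
    unfolding star_multiplier_def
    by (subst make_multiplier; simp add: * adj multiplier_rules star_scaleC star_mult star_star)+
qed

instance
proof
  fix m n :: "'a multiplier" and c d :: complex and r :: real
  note [simp] = multiplier_add multiplier_scaleC multiplier_scaleR multiplier_mult multiplier_star
  show "c *\<^sub>C (m + n) = c *\<^sub>C m + c *\<^sub>C n" "(c + d) *\<^sub>C m = c *\<^sub>C m + d *\<^sub>C m"
    "c *\<^sub>C d *\<^sub>C m = (c * d) *\<^sub>C m" "r *\<^sub>R m = complex_of_real r *\<^sub>C m"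
    "c *\<^sub>C m * n = c *\<^sub>C (m * n)" "m * c *\<^sub>C n = c *\<^sub>C (m * n)"
    by (rule multiplier_eqI; simp add: scaleC_add_left scaleC_add_right scaleC_scaleC
        scaleR_scaleC mult_left_scaleC)+
  show "star (star m) = m" "star (m + n) = star m + star n" "star (c *\<^sub>C m) = cnj c *\<^sub>C star m"
    "star (m * n) = star n * star m"
    by (rule multiplier_eqI; simp add: star_star star_add star_scaleC)+
  have le: "norm (c *\<^sub>C m) \<le> cmod c * norm m" for c and m :: "'a multiplier"
    using norm_multiplier_left[of m]
    by (intro norm_multiplier_le) (simp_all add: norm_scaleC mult_left_mono mult.assoc)
  show "norm (c *\<^sub>C m) = cmod c * norm m"
  proof (cases "c = 0")
    case False
    have "inverse c *\<^sub>C (c *\<^sub>C m) = m"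
      by (rule multiplier_eqI) (use False in \<open>simp add: scaleC_scaleC scaleC_one\<close>)
    with le[of "inverse c" "c *\<^sub>C m"] have "norm m \<le> inverse (cmod c) * norm (c *\<^sub>C m)"
      by (simp add: norm_inverse)
    with False have "cmod c * norm m \<le> norm (c *\<^sub>C m)"
      by (simp add: field_simps)
    with le[of c m] show ?thesis by simp
  qed (use le[of 0 m] in simp)
  have starle: "norm (star m) \<le> norm m"
    using norm_multiplier_right[of "star _" m] by (intro norm_multiplier_le) (simp_all add: norm_star)
  show "norm (star m * m) = (norm m)\<^sup>2"
  proof (rule antisym)
    show "norm (star m * m) \<le> (norm m)\<^sup>2"
      using norm_mult_ineq[of "star m" m] mult_right_mono[OF starle, of "norm m"]
      by (simp add: power2_eq_square)
    have "norm (m \<cdot>\<^sub>L b) \<le> sqrt (norm (star m * m)) * norm b" for b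
    proof -
      have "(norm (m \<cdot>\<^sub>L b))\<^sup>2 = norm (star ((star m * m) \<cdot>\<^sub>L b) * b)"
        by (simp add: cstar_identity[symmetric] star_star mult_right_left)
      also have "\<dots> \<le> norm ((star m * m) \<cdot>\<^sub>L b) * norm b"
        by (metis norm_mult_ineq norm_star)
      also have "\<dots> \<le> norm (star m * m) * norm b * norm b"
        by (intro mult_right_mono norm_multiplier_left) auto
      finally have "(norm (m \<cdot>\<^sub>L b))\<^sup>2 \<le> norm (star m * m) * (norm b)\<^sup>2"
        by (simp add: power2_eq_square mult.assoc)
      from real_le_rsqrt[OF this] show ?thesis by (simp add: real_sqrt_mult)
    qed
    then have "norm m \<le> sqrt (norm (star m * m))" by (intro norm_multiplier_le) auto
    from power_mono[OF this, of 2] show "(norm m)\<^sup>2 \<le> norm (star m * m)" by simp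
  qed
qed

end

definition embed :: "'a::cstar_algebra \<Rightarrow> 'a multiplier" where
  "embed a = make_multiplier (\<lambda>b. a * b) (\<lambda>b. b * a)"

lemma embed: "embed a \<cdot>\<^sub>L b = a * b" "b \<cdot>\<^sub>R embed a = b * a"
  unfolding embed_def
  by (subst make_multiplier; simp add: mult_scaleC_left mult_scaleC_right mult.assoc
      bounded_linear_mult_right
      bounded_linear_mult_left)+

section \<open>The strict topology\<close>

text \<open>Generated by the seminorms \<open>m \<mapsto> norm (m b)\<close> and \<open>m \<mapsto> norm (b m)\<close>, for \<open>b\<close> in the algebra.\<close>

definition strict_topology :: "'a::cstar_algebra multiplier topology" where
  "strict_topology = topology_generated_by
     ({{n. norm ((n - m) \<cdot>\<^sub>L b) < e} | m b e. e > 0} \<union>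
      {{n. norm (b \<cdot>\<^sub>R (n - m)) < e} | m b e. e > 0})"

section \<open>Group actions\<close>

definition star_automorphism :: "('a::cstar_algebra \<Rightarrow> 'a) \<Rightarrow> bool" where
  "star_automorphism \<phi> \<longleftrightarrow> bij \<phi> \<and>
     (\<forall>x y. \<phi> (x + y) = \<phi> x + \<phi> y) \<and> (\<forall>c x. \<phi> (c *\<^sub>C x) = c *\<^sub>C \<phi> x) \<and>
     (\<forall>x y. \<phi> (x * y) = \<phi> x * \<phi> y) \<and> (\<forall>x. \<phi> (star x) = star (\<phi> x))"

text \<open>The extension to the multiplier algebra by strict continuity; it is unique because the
  algebra is strictly dense in its multiplier algebra.\<close>

definition strict_extension ::
  "('a::cstar_algebra \<Rightarrow> 'a) \<Rightarrow> 'a multiplier \<Rightarrow> 'a multiplier" where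
  "strict_extension \<phi> = (THE \<psi>. continuous_map strict_topology strict_topology \<psi> \<and>
     (\<forall>a. \<psi> (embed a) = embed (\<phi> a)))"

text \<open>The group is written additively, as in the library class \<^class>\<open>topological_group_add\<close>,
  which does not require commutativity.\<close>

definition norm_continuous_action ::
  "('g::topological_group_add \<Rightarrow> 'a::cstar_algebra \<Rightarrow> 'a) \<Rightarrow> bool" where
  "norm_continuous_action \<alpha> \<longleftrightarrow> (\<forall>t. star_automorphism (\<alpha> t)) \<and>
     (\<forall>s t. \<alpha> (s + t) = \<alpha> s \<circ> \<alpha> t) \<and> (\<forall>a. continuous_on UNIV (\<lambda>t. \<alpha> t a))"

section \<open>Integration\<close>

text \<open>Inner regularity is demanded of open sets only, so that Haar measure is covered for groups
  that are not \<open>\<sigma>\<close>-compact.\<close>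

definition regular_borel_measure :: "'x::t2_space measure \<Rightarrow> bool" where
  "regular_borel_measure \<mu> \<longleftrightarrow> sets \<mu> = sets borel \<and>
     (\<forall>K. compact K \<longrightarrow> emeasure \<mu> K < \<infinity>) \<and>
     (\<forall>B\<in>sets borel. emeasure \<mu> B = (INF U\<in>{U. open U \<and> B \<subseteq> U}. emeasure \<mu> U)) \<and>
     (\<forall>U. open U \<longrightarrow> emeasure \<mu> U = (SUP K\<in>{K. compact K \<and> K \<subseteq> U}. emeasure \<mu> K))"

text \<open>The library's \<^const>\<open>has_bochner_integral\<close> is confined to second countable range types. The
  following is the same definition without that restriction, as needed for algebras that are not
  separable.\<close>

definition has_norm_integral :: "'x measure \<Rightarrow> ('x \<Rightarrow> 'a::banach) \<Rightarrow> 'a \<Rightarrow> bool" where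
  "has_norm_integral \<mu> h x \<longleftrightarrow> h \<in> borel_measurable \<mu> \<and>
     (\<exists>s. (\<forall>i. Bochner_Integration.simple_bochner_integrable \<mu> (s i)) \<and>
          (\<lambda>i. \<integral>\<^sup>+t. ennreal (norm (h t - s i t)) \<partial>\<mu>) \<longlonglongrightarrow> 0 \<and>
          (\<lambda>i. Bochner_Integration.simple_bochner_integral \<mu> (s i)) \<longlonglongrightarrow> x)"

definition has_strict_integral ::
  "'x measure \<Rightarrow> ('x \<Rightarrow> 'a::cstar_algebra multiplier) \<Rightarrow> 'a multiplier \<Rightarrow> bool" where
  "has_strict_integral \<mu> h m \<longleftrightarrow>
     (\<forall>b. has_norm_integral \<mu> (\<lambda>t. h t \<cdot>\<^sub>L b) (m \<cdot>\<^sub>L b) \<and>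
          has_norm_integral \<mu> (\<lambda>t. b \<cdot>\<^sub>R h t) (b \<cdot>\<^sub>R m))"

definition strict_integral ::
  "'x measure \<Rightarrow> ('x \<Rightarrow> 'a::cstar_algebra multiplier) \<Rightarrow> 'a multiplier" where
  "strict_integral \<mu> h = (THE m. has_strict_integral \<mu> h m)"

section \<open>Nets\<close>

definition directed_set :: "'i set \<Rightarrow> ('i \<Rightarrow> 'i \<Rightarrow> bool) \<Rightarrow> bool" where
  "directed_set I le \<longleftrightarrow> I \<noteq> {} \<and> reflp_on I le \<and> transp_on I le \<and>
     (\<forall>i\<in>I. \<forall>j\<in>I. \<exists>k\<in>I. le i k \<and> le j k)"

definition net_filter :: "'i set \<Rightarrow> ('i \<Rightarrow> 'i \<Rightarrow> bool) \<Rightarrow> 'i filter" where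
  "net_filter I le = (INF i\<in>I. principal {j\<in>I. le i j})"

lemma eventually_net_filter:
  assumes "directed_set I le"
  shows "eventually P (net_filter I le) \<longleftrightarrow> (\<exists>i\<in>I. \<forall>j\<in>I. le i j \<longrightarrow> P j)"
  unfolding net_filter_def
proof (subst eventually_INF_base)
  show "I \<noteq> {}" using assms by (simp add: directed_set_def)
  fix i j assume "i \<in> I" "j \<in> I"
  then obtain k where "k \<in> I" "le i k" "le j k" using assms by (auto simp: directed_set_def)
  with assms \<open>i \<in> I\<close> \<open>j \<in> I\<close>
  show "\<exists>k\<in>I. principal {l\<in>I. le k l} \<le> inf (principal {l\<in>I. le i l}) (principal {l\<in>I. le j l})"
    by (auto simp: directed_set_def intro!: bexI[of _ k] dest: transp_onD)
qed (auto simp: eventually_principal)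

end

theory Submission
  imports Defs
begin

text \<open>
  For \<open>b\<close> in the algebra the integrand satisfies
  \<open>f(t) \<alpha>\<^sub>t(m) b = f(t) \<alpha>\<^sub>t(m \<alpha>\<^bsub>-t\<^esub>(b))\<close>, and similarly from the other side, so everything
  reduces to the norm integrals of \<open>t \<mapsto> f(t) \<alpha>\<^sub>t(T(\<alpha>\<^bsub>-t\<^esub>(b)))\<close>, where \<open>T\<close> is the left or right
  multiplication by a multiplier. Because every \<open>\<alpha>\<^sub>t\<close> is isometric, such an integral is bounded by
  \<open>\<parallel>f\<parallel>\<^sub>1 \<parallel>T\<parallel> \<parallel>b\<parallel>\<close>, which gives boundedness of the net.

  Dominated convergence fails for nets, so the limit is taken by compactness
  (\<open>has_average_tendsto\<close>). Regularity of \<open>\<mu>\<close> provides a compact \<open>K\<close> outside which \<open>|f|\<close> has small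
  integral (\<open>integral_concentrated_on_compact\<close>). The orbit \<open>{\<alpha>\<^bsub>-t\<^esub>(b) | t \<in> K}\<close> is compact, and a
  bounded net of operators that converges pointwise converges uniformly on compact sets, so the
  integral over \<open>K\<close> converges; the rest is small by boundedness. The same compact sets show that
  the integrals exist: the integrand is norm continuous, hence uniformly approximable on \<open>K\<close> by
  simple functions (\<open>has_norm_integral_dominated\<close>). As \<open>b\<close> varies, the integrals for left and
  right multiplication form a double centralizer (\<open>has_strict_integral_exists\<close>).

  Two facts on C*-algebras are needed first.

  \<^item> Automorphisms are isometric (\<open>norm_star_automorphism_le\<close>). Elements of norm below \<open>1\<close> are
    quasi-invertible, and homomorphisms preserve quasi-invertibility; conversely, if \<open>k\<close> is
    self-adjoint of norm \<open>1\<close>, some \<open>c k\<close> with \<open>|c| \<le> 1\<close> is not quasi-invertible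
    (\<open>self_adjoint_not_quasi_invertible\<close>). In other words, the norm of a self-adjoint
    element is its spectral radius, a quantity that automorphisms preserve.

  \<^item> The algebra is strictly dense in its multiplier algebra (\<open>strict_closure_of_embed\<close>), which
    makes the strictly continuous extension of an automorphism \<open>\<phi>\<close> unique and identifies it as
    \<open>m \<mapsto> \<phi> \<circ> m \<circ> inv \<phi>\<close> (\<open>strict_extension_apply\<close>). Approximate units come from the
    contractions \<open>(1 + i s h)\<^bsup>-1\<^esup>\<close> with \<open>h = b\<^sup>* b\<close> and large real \<open>s\<close>.
\<close>

section \<open>Quasi-inverses and the isometry of automorphisms\<close>

text \<open>In terms of an adjoined unit, \<open>1 + y\<close> is the inverse of \<open>1 - x\<close>. Quasi-inverses express
  invertibility in algebras without a unit.\<close>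

definition quasi_inverse :: "'a::ring \<Rightarrow> 'a \<Rightarrow> bool" where
  "quasi_inverse x y \<longleftrightarrow> y = x + x * y \<and> y = x + y * x"

lemma quasi_inverseI: "x * y = y - x \<Longrightarrow> y * x = y - x \<Longrightarrow> quasi_inverse x y"
  by (simp add: quasi_inverse_def)

lemma quasi_inverseD:
  assumes "quasi_inverse x y"
  shows "x * y = y - x" "y * x = y - x"
  using assms unfolding quasi_inverse_def by (metis add_diff_cancel_left')+

text \<open>The Neumann series \<open>x + x\<^sup>2 + x\<^sup>3 + \<dots>\<close>.\<close>

lemma quasi_inverse_exists:
  fixes x :: "'a::{real_normed_algebra, banach}"
  assumes "norm x < 1"
  shows "\<exists>y. quasi_inverse x y"
proof -
  define p where "p n = ((*) x ^^ n) x" for n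
  have p0: "p 0 = x" and pS: "p (Suc n) = x * p n" for n
    by (simp_all add: p_def)
  have pS': "p n * x = p (Suc n)" for n
    by (induction n) (simp_all add: p0 pS mult.assoc)
  have "norm (p n) \<le> norm x ^ Suc n" for n
  proof (induction n)
    case (Suc n)
    have "norm (p (Suc n)) \<le> norm x * norm (p n)"
      by (simp add: pS norm_mult_ineq)
    also have "\<dots> \<le> norm x * norm x ^ Suc n"
      using Suc by (intro mult_left_mono) auto
    finally show ?case by simp
  qed (simp add: p0)
  moreover have "summable (\<lambda>n. norm x ^ Suc n)"
    using assms by (subst summable_Suc_iff) (simp add: summable_geometric)
  ultimately have s: "summable p"
    by (rule summable_comparison_test'[where N = 0, rotated])
  have *: "suminf p = x + (\<Sum>n. p (Suc n))"
    using suminf_split_head[OF s] by (simp add: p0)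
  have "(\<Sum>n. p (Suc n)) = x * suminf p"
    using suminf_mult[OF s, of x] by (simp add: pS)
  moreover have "(\<Sum>n. p (Suc n)) = suminf p * x"
    using suminf_mult2[OF s, of x] by (simp add: pS')
  ultimately have "quasi_inverse x (suminf p)"
    unfolding quasi_inverse_def using * by metis
  then show ?thesis ..
qed

text \<open>Partial fractions: \<open>(1 - x\<^sup>2)\<^bsup>-1\<^esup>\<close> is the mean of \<open>(1 - x)\<^bsup>-1\<^esup>\<close> and \<open>(1 + x)\<^bsup>-1\<^esup>\<close>.\<close>

lemma quasi_inverse_square:
  fixes x :: "'a::real_algebra"
  assumes "quasi_inverse x y" "quasi_inverse (- x) z"
  shows "quasi_inverse (x * x) ((1/2) *\<^sub>R (y + z))"
proof -
  note D = quasi_inverseD[OF assms(1)] quasi_inverseD[OF assms(2)]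
  have xz: "x * z = - x - z" "z * x = - x - z"
    using D(3,4) by (metis add.commute add_uminus_conv_diff minus_diff_eq minus_mult_left minus_mult_right minus_minus)+
  have 1: "x * x * y = y - x - x * x"
    by (simp add: mult.assoc D algebra_simps)
  have 2: "y * (x * x) = y - x - x * x"
    by (simp add: D algebra_simps flip: mult.assoc)
  have 3: "x * x * z = z + x - x * x"
    by (simp add: mult.assoc xz algebra_simps)
  have 4: "z * (x * x) = z + x - x * x"
    by (simp add: xz algebra_simps flip: mult.assoc)
  have half: "(1/2) *\<^sub>R (u + u) = u" for u :: 'a
    by (simp flip: scaleR_2)
  have "x * x * (y + z) = (y + z) - (x * x + x * x)" "(y + z) * (x * x) = (y + z) - (x * x + x * x)"
    using 1 2 3 4 by (simp_all add: algebra_simps)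
  then show ?thesis
    by (intro quasi_inverseI) (simp_all add: scaleR_diff_right half)
qed

text \<open>The resolvent identity, for the resolvents \<open>(1 - c k)\<^bsup>-1\<^esup>\<close> and \<open>(1 - d k)\<^bsup>-1\<^esup>\<close>.\<close>

lemma quasi_inverse_scaleC_diff:
  fixes k :: "'a::cstar_algebra"
  assumes "quasi_inverse (c *\<^sub>C k) y" "quasi_inverse (d *\<^sub>C k) z"
  shows "z - y = (d - c) *\<^sub>C ((k + y * k) + (k + y * k) * z)"
proof -
  define B where "B = k + y * k"
  have c: "c *\<^sub>C B = y"
    using quasi_inverseD[OF assms(1)] by (simp add: B_def scaleC_add_right flip: mult_scaleC_right)
  have kz: "d *\<^sub>C (k + k * z) = z"
    using quasi_inverseD[OF assms(2)] by (simp add: scaleC_add_right flip: mult_scaleC_left)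
  have "d *\<^sub>C (B + B * z) = d *\<^sub>C ((k + k * z) + y * (k + k * z))"
    by (simp add: B_def algebra_simps)
  also have "\<dots> = z + y * z"
    by (subst scaleC_add_right) (simp only: mult_scaleC_right[symmetric] kz)
  finally have d: "d *\<^sub>C (B + B * z) = z + y * z" .
  have "c *\<^sub>C (B + B * z) = y + y * z"
    by (simp add: scaleC_add_right c mult_scaleC_left[symmetric])
  moreover have "(d - c) *\<^sub>C (B + B * z) = d *\<^sub>C (B + B * z) - c *\<^sub>C (B + B * z)"
    using scaleC_add_left[of "d - c" c "B + B * z"] by simp
  ultimately show ?thesis
    using d by (simp add: B_def)
qed

lemma continuous_on_quasi_inverse:
  fixes k :: "'a::cstar_algebra"
  assumes S: "\<And>c. c \<in> D \<Longrightarrow> quasi_inverse (c *\<^sub>C k) (S c)"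
  shows "continuous_on D S"
  unfolding continuous_on_iff
proof (intro ballI allI impI)
  fix c and e :: real
  assume c: "c \<in> D" and e: "0 < e"
  define B where "B = k + S c * k"
  define C where "C = norm (B + B * S c)"
  define r where "r = min (1 / (2 * (norm B + 1))) (e / (2 * (C + 1)))"
  have C: "0 \<le> C" by (simp add: C_def)
  have r: "0 < r" using e C by (auto simp: r_def intro!: divide_pos_pos add_nonneg_pos)
  have "dist (S d) (S c) < e" if d: "d \<in> D" and near: "dist d c < r" for d
  proof -
    let ?n = "norm (S d - S c)" and ?t = "cmod (d - c)"
    have t: "?t < 1 / (2 * (norm B + 1))" "?t < e / (2 * (C + 1))"
      using near by (auto simp: r_def dist_norm)
    have "S d - S c = (d - c) *\<^sub>C ((B + B * S c) + B * (S d - S c))"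
      using quasi_inverse_scaleC_diff[OF S[OF c] S[OF d]] by (simp add: B_def algebra_simps)
    then have "?n = ?t * norm ((B + B * S c) + B * (S d - S c))"
      by (metis norm_scaleC)
    also have "\<dots> \<le> ?t * (C + norm B * ?n)"
      unfolding C_def by (intro mult_left_mono norm_triangle_mono norm_mult_ineq) auto
    also have "\<dots> = ?t * C + (?t * norm B) * ?n" by (simp add: algebra_simps)
    also have "\<dots> \<le> ?t * C + (1/2) * ?n"
    proof -
      have "?t * norm B \<le> ?t * (norm B + 1)" by (intro mult_left_mono) auto
      also have "\<dots> \<le> 1/2"
      proof -
        have "0 < 2 * (norm B + 1)" by (simp add: add_nonneg_pos)
        with t(1) have "?t * (2 * (norm B + 1)) < 1" by (simp only: pos_less_divide_eq)
        then show ?thesis by (simp add: algebra_simps)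
      qed
      finally show ?thesis by (intro add_left_mono mult_right_mono) auto
    qed
    finally have "?n \<le> 2 * ?t * C" by simp
    also have "\<dots> \<le> 2 * ?t * (C + 1)" by (intro mult_left_mono) auto
    also have "\<dots> < e" using t(2) C by (simp add: field_simps)
    finally show ?thesis by (simp add: dist_norm)
  qed
  with r show "\<exists>d>0. \<forall>x'\<in>D. dist x' c < d \<longrightarrow> dist (S x') (S c) < e" by blast
qed

text \<open>Suppose that \<open>S(c)\<close> is a quasi-inverse of \<open>c k\<close> for all \<open>|c| \<le> 1\<close>. By compactness, \<open>S\<close> varies by
  at most \<open>1/8\<close> between \<open>c\<close> and \<open>r c\<close> for some \<open>r < 1\<close>. Replacing \<open>k\<close> by \<open>k\<^sup>2\<close> and \<open>r\<close> by \<open>r\<^sup>2\<close>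
  preserves this bound, since the new quasi-inverses are means of old ones, and it preserves
  \<open>\<parallel>k\<parallel> = 1\<close> by the C*-identity. Repetition drives \<open>r\<close> to \<open>0\<close>: then the quasi-inverse of \<open>r k\<close> is
  small, whereas that of \<open>k\<close> has norm at least \<open>1/2\<close>.\<close>

lemma self_adjoint_not_quasi_invertible:
  fixes k :: "'a::cstar_algebra"
  assumes sa: "star k = k" and nk: "norm k = 1"
  shows "\<exists>c. cmod c \<le> 1 \<and> \<not> (\<exists>y. quasi_inverse (c *\<^sub>C k) y)"
proof (rule ccontr)
  assume "\<not> ?thesis"
  then obtain S where S: "\<And>c. c \<in> cball 0 1 \<Longrightarrow> quasi_inverse (c *\<^sub>C k) (S c)"
    by (auto simp: mem_cball_0) metis
  have "uniformly_continuous_on (cball 0 1) S"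
    by (intro compact_uniformly_continuous continuous_on_quasi_inverse[where k = k] compact_cball) (rule S)
  then obtain d where d: "d > 0"
    "\<And>c c'. c \<in> cball 0 1 \<Longrightarrow> c' \<in> cball 0 1 \<Longrightarrow> dist c' c < d \<Longrightarrow> dist (S c') (S c) < 1/8"
    unfolding uniformly_continuous_on_def by (metis zero_less_divide_1_iff zero_less_numeral)
  define r where "r = max (1/2) (1 - d/2)"
  have r: "0 < r" "r < 1" "1 - r < d"
    using d(1) by (auto simp: r_def max_def)
  \<comment> \<open>Repeated squaring: \<open>q n\<close> is the power of \<open>k\<close> with exponent \<open>2 ^ n\<close>.\<close>
  define q where "q n = ((\<lambda>x. x * x) ^^ n) k" for n
  have q0: "q 0 = k" and qS: "q (Suc n) = q n * q n" for n
    by (simp_all add: q_def)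
  have q: "star (q n) = q n \<and> norm (q n) = 1" for n
  proof (induction n)
    case (Suc n)
    then show ?case
      using cstar_identity[of "q n"] by (simp add: qS star_mult)
  qed (simp add: q0 sa nk)
  have close: "\<exists>y z. quasi_inverse (c *\<^sub>C q n) y \<and> quasi_inverse ((of_real (r ^ 2 ^ n) * c) *\<^sub>C q n) z \<and>
      norm (y - z) \<le> 1/8" if "cmod c \<le> 1" for c n
    using that
  proof (induction n arbitrary: c)
    case 0
    have 1: "c \<in> cball 0 1" using 0 by simp
    have 2: "of_real r * c \<in> cball 0 1"
      using 0 r by (simp add: norm_mult mult_le_one)
    have "c - of_real r * c = of_real (1 - r) * c" by (simp add: algebra_simps)
    then have "dist c (of_real r * c) = (1 - r) * cmod c"
      using r by (simp add: dist_norm norm_mult flip: of_real_diff)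
    also have "\<dots> \<le> (1 - r) * 1"
      using r 0 by (intro mult_left_mono) auto
    also have "\<dots> < d" using r by simp
    finally have "dist (S c) (S (of_real r * c)) < 1/8" by (rule d(2)[OF 2 1])
    with S[OF 1] S[OF 2] show ?case
      by (intro exI[of _ "S c"] exI[of _ "S (of_real r * c)"]) (auto simp: q0 dist_norm)
  next
    case (Suc n)
    let ?b = "csqrt c" and ?R = "complex_of_real (r ^ 2 ^ n)"
    have bb: "?b * ?b = c" by (metis power2_csqrt power2_eq_square)
    have nb: "cmod ?b \<le> 1" "cmod (- ?b) \<le> 1" using Suc.prems by (simp_all add: norm_csqrt)
    obtain y z where y: "quasi_inverse (?b *\<^sub>C q n) y"
      and z: "quasi_inverse ((?R * ?b) *\<^sub>C q n) z" and yz: "norm (y - z) \<le> 1/8"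
      using Suc.IH[OF nb(1)] by blast
    obtain y' z' where y': "quasi_inverse ((- ?b) *\<^sub>C q n) y'"
      and z': "quasi_inverse ((?R * - ?b) *\<^sub>C q n) z'" and yz': "norm (y' - z') \<le> 1/8"
      using Suc.IH[OF nb(2)] by blast
    have neg: "(- a) *\<^sub>C q n = - (a *\<^sub>C q n)" for a
      using scaleC_scaleC[of "-1" a "q n"] by (simp add: scaleC_minus_one)
    have sq: "(a *\<^sub>C q n) * (a *\<^sub>C q n) = (a * a) *\<^sub>C q (Suc n)" for a
      by (simp add: mult_scaleC_left mult_scaleC_right scaleC_scaleC qS)
    have 1: "quasi_inverse (c *\<^sub>C q (Suc n)) ((1/2) *\<^sub>R (y + y'))"
      using quasi_inverse_square[OF y y'[unfolded neg]] by (simp add: sq bb)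
    have RR: "?R * ?b * (?R * ?b) = of_real (r ^ 2 ^ Suc n) * c"
      using bb by (simp add: mult_ac power_add mult_2) 
    have 2: "quasi_inverse ((of_real (r ^ 2 ^ Suc n) * c) *\<^sub>C q (Suc n)) ((1/2) *\<^sub>R (z + z'))"
      using quasi_inverse_square[OF z z'[unfolded mult_minus_right neg]] by (simp only: sq RR)
    have "(1/2) *\<^sub>R (y + y') - (1/2) *\<^sub>R (z + z') = (1/2) *\<^sub>R ((y - z) + (y' - z'))"
      by (simp add: algebra_simps)
    then have "norm ((1/2) *\<^sub>R (y + y') - (1/2) *\<^sub>R (z + z')) \<le> 1/8"
      using norm_triangle_ineq[of "y - z" "y' - z'"] yz yz' by simp
    with 1 2 show ?case by blast
  qed
  have "(\<lambda>n. r ^ n) \<longlonglongrightarrow> 0" using r by (intro LIMSEQ_power_zero) auto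
  then have "eventually (\<lambda>n. r ^ n < 1/9) sequentially"
    by (rule order_tendstoD) simp
  then obtain n where "r ^ n < 1/9" by (metis eventually_happens sequentially_bot)
  moreover have "r ^ 2 ^ n \<le> r ^ n" using r by (intro power_decreasing) auto
  ultimately have R: "r ^ 2 ^ n < 1/9" "0 < r ^ 2 ^ n" using r by (blast intro: le_less_trans, simp)
  let ?s = "r ^ 2 ^ n"
  obtain y z where y: "quasi_inverse (1 *\<^sub>C q n) y"
    and z: "quasi_inverse ((of_real ?s * 1) *\<^sub>C q n) z" and yz: "norm (y - z) \<le> 1/8"
    using close[of 1 n] by auto
  have "q n = y - q n * y"
    using quasi_inverseD(1)[OF y] by (simp add: scaleC_one)
  then have "1 \<le> norm y + norm (q n * y)"
    by (metis q norm_triangle_ineq4)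
  also have "\<dots> \<le> norm y + 1 * norm y"
    using norm_mult_ineq[of "q n" y] q[of n] by auto
  finally have "1/2 \<le> norm y" by simp
  moreover have "z = ?s *\<^sub>R (q n + q n * z)"
    using quasi_inverseD(1)[OF z]
    by (simp add: scaleC_add_right scaleR_scaleC mult_scaleC_left del: of_real_power)
  then have "norm z = ?s * norm (q n + q n * z)"
    using R by (metis norm_scaleR abs_of_pos)
  moreover have "norm (q n + q n * z) \<le> 1 + norm z"
    using norm_triangle_ineq[of "q n" "q n * z"] norm_mult_ineq[of "q n" z] q[of n] by simp
  then have "?s * norm (q n + q n * z) \<le> (1/9) * (1 + norm z)"
    using R by (intro mult_mono) auto
  ultimately show False
    using yz norm_triangle_ineq2[of y z] by simp
qed

lemma star_automorphism_rules:
  assumes "star_automorphism \<phi>"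
  shows "\<phi> (x + y) = \<phi> x + \<phi> y" "\<phi> (c *\<^sub>C x) = c *\<^sub>C \<phi> x" "\<phi> (r *\<^sub>R x) = r *\<^sub>R \<phi> x"
    "\<phi> (x * y) = \<phi> x * \<phi> y" "\<phi> (star x) = star (\<phi> x)" "bij \<phi>"
  using assms by (simp_all add: star_automorphism_def scaleR_scaleC)

text \<open>If \<open>\<parallel>\<phi>(h)\<parallel> > \<parallel>h\<parallel>\<close> with \<open>h\<close> self-adjoint, rescale so that \<open>\<parallel>\<phi>(h)\<parallel> = 1\<close>; then \<open>c h\<close> is
  quasi-invertible for all \<open>|c| \<le> 1\<close> by the Neumann series, hence so is \<open>c \<phi>(h)\<close>, which is
  impossible. The C*-identity extends the bound from self-adjoint to arbitrary elements.\<close>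

lemma norm_star_automorphism_le:
  assumes \<phi>: "star_automorphism \<phi>"
  shows "norm (\<phi> x) \<le> norm x"
proof -
  note rules = star_automorphism_rules[OF \<phi>]
  have sa: "norm (\<phi> h) \<le> norm h" if h: "star h = h" for h
  proof (rule ccontr)
    assume less: "\<not> ?thesis"
    define c where "c = norm (\<phi> h)"
    have c: "norm h < c" "0 < c" using less by (auto simp: c_def intro: le_less_trans)
    let ?k = "(1/c) *\<^sub>R \<phi> h"
    have "star ?k = ?k" by (simp add: star_scaleR h flip: rules(5))
    moreover have "norm ?k = 1" using c by (simp add: c_def)
    ultimately obtain l where l: "cmod l \<le> 1" "\<nexists>y. quasi_inverse (l *\<^sub>C ?k) y"
      using self_adjoint_not_quasi_invertible by blast
    have "norm (l *\<^sub>C (1/c) *\<^sub>R h) = cmod l * (norm h / c)"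
      using c by (simp add: norm_scaleC)
    also have "\<dots> \<le> 1 * (norm h / c)" using l c by (intro mult_right_mono) auto
    also have "\<dots> < 1" using c by simp
    finally obtain y where "quasi_inverse (l *\<^sub>C (1/c) *\<^sub>R h) y"
      using quasi_inverse_exists by blast
    then have "quasi_inverse (l *\<^sub>C ?k) (\<phi> y)"
      unfolding quasi_inverse_def by (metis rules(1-4))
    with l show False by blast
  qed
  have "(norm (\<phi> x))\<^sup>2 = norm (\<phi> (star x * x))"
    by (simp add: cstar_identity rules)
  also have "\<dots> \<le> (norm x)\<^sup>2"
    using sa[of "star x * x"] by (simp add: cstar_identity star_mult star_star)
  finally show ?thesis by (rule power2_le_imp_le) simp
qed

lemma bounded_linear_star_automorphism:
  "star_automorphism \<phi> \<Longrightarrow> bounded_linear \<phi>"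
  by (rule bounded_linear_intro[of _ 1]) (simp_all add: star_automorphism_rules norm_star_automorphism_le)

lemma star_automorphism_inv:
  assumes "star_automorphism \<phi>"
  shows "star_automorphism (inv \<phi>)"
proof -
  note r = star_automorphism_rules[OF assms]
  have i: "inv \<phi> (\<phi> x) = x" "\<phi> (inv \<phi> x) = x" for x
    using r(6) by (simp_all add: bij_is_inj bij_is_surj surj_f_inv_f)
  show ?thesis
    unfolding star_automorphism_def
    by (intro conjI allI bij_imp_bij_inv[OF r(6)]; metis i r(1-5))
qed


section \<open>Approximate units\<close>

definition mult_unit :: "'a::cstar_algebra multiplier" where
  "mult_unit = make_multiplier (\<lambda>b. b) (\<lambda>b. b)"

lemma mult_unit_apply [simp]: "mult_unit \<cdot>\<^sub>L b = b" "b \<cdot>\<^sub>R mult_unit = b"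
  unfolding mult_unit_def by (subst make_multiplier; simp add: bounded_linear_ident)+

lemma mult_unit_times [simp]: "mult_unit * m = m" "m * mult_unit = m"
  by (rule multiplier_eqI; simp add: multiplier_mult)+

lemma star_mult_unit [simp]: "star mult_unit = mult_unit"
  by (rule multiplier_eqI) (simp add: multiplier_star star_star)

lemma norm_mult_unit_le: "norm mult_unit \<le> 1"
  by (rule norm_multiplier_le) simp_all

lemma embed_ideal:
  "m * embed a = embed (m \<cdot>\<^sub>L a)" "embed a * m = embed (a \<cdot>\<^sub>R m)"
  by (rule multiplier_eqI; simp add: multiplier_mult embed mult_left_mult mult_right_left)+

lemma embed_linear:
  "embed (a + b) = embed a + embed b" "embed (- a) = - embed a" "embed (c *\<^sub>C a) = c *\<^sub>C embed a"
  by (rule multiplier_eqI; simp add: multiplier_add multiplier_uminus multiplier_scaleC embed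
      distrib_right mult_scaleC_left)+

lemma star_embed: "star (embed a) = embed (star a)"
  by (rule multiplier_eqI) (simp add: multiplier_star embed star_mult star_star)

lemma norm_le_norm_embed: "norm a \<le> norm (embed a)"
proof (cases "a = 0")
  case False
  have "norm a * norm a = norm (embed a \<cdot>\<^sub>L star a)"
    using cstar_identity[of "star a"] by (simp add: embed star_star norm_star power2_eq_square)
  also have "\<dots> \<le> norm (embed a) * norm a"
    using norm_multiplier_left[of "embed a" "star a"] by (simp add: norm_star)
  finally show ?thesis using False by simp
qed simp

definition inverse_multipliers :: "'a::cstar_algebra multiplier \<Rightarrow> 'a multiplier \<Rightarrow> bool" where
  "inverse_multipliers m n \<longleftrightarrow> m * n = mult_unit \<and> n * m = mult_unit"

text \<open>The Cayley transform \<open>w = (1 - i s H)(1 + i s H)\<^bsup>-1\<^esup>\<close> is unitary, so \<open>\<parallel>w\<parallel> \<le> 1\<close>, and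
  \<open>(1 + i s H)\<^bsup>-1\<^esup> = (1 + w) / 2\<close>.\<close>

lemma norm_inverse_imaginary_le:
  assumes H: "star H = H" and g: "inverse_multipliers (mult_unit + Complex 0 s *\<^sub>C H) g"
  shows "norm g \<le> 1"
proof -
  let ?p = "mult_unit + Complex 0 s *\<^sub>C H" and ?m = "mult_unit - Complex 0 s *\<^sub>C H"
  have neg: "Complex 0 (- s) *\<^sub>C H = - (Complex 0 s *\<^sub>C H)"
    using scaleC_scaleC[of "-1" "Complex 0 s" H]
    by (simp add: scaleC_minus_one) (metis complex_minus minus_zero)
  have "cnj (Complex 0 s) = Complex 0 (- s)" by (simp add: complex_eq_iff)
  then have p: "star ?p = ?m"
    by (simp add: star_add star_scaleC H neg)
  then have st: "star ?p = ?m" "star ?m = ?p"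
    by (metis star_star)+
  have comm: "?p * ?m = ?m * ?p" by (simp add: algebra_simps)
  have pg: "?p * g = mult_unit" using g by (simp add: inverse_multipliers_def)
  have gm: "star g * ?m = mult_unit"
    using arg_cong[OF pg, of star] by (simp only: star_mult st star_mult_unit)
  define w where "w = ?m * g"
  have "star w * w = star g * (?p * ?m) * g"
    by (simp only: w_def star_mult st mult.assoc)
  also have "\<dots> = (star g * ?m) * (?p * g)"
    by (simp only: comm mult.assoc)
  also have "\<dots> = mult_unit" by (simp only: pg gm mult_unit_times)
  finally have "(norm w)\<^sup>2 \<le> 1"
    using norm_mult_unit_le by (metis cstar_identity)
  then have w: "norm w \<le> 1" by (simp add: power_le_one_iff)
  have "w + mult_unit = (?m + ?p) * g" by (simp only: w_def distrib_right[of ?m ?p g] pg)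
  also have "\<dots> = g + g" by (simp add: algebra_simps)
  finally have "2 *\<^sub>R g = w + mult_unit" by (simp add: scaleR_2)
  then have "2 * norm g \<le> 1 + 1"
    using norm_triangle_mono[OF w norm_mult_unit_le] by (metis abs_numeral norm_scaleR)
  then show ?thesis by simp
qed

text \<open>Factor \<open>m + d = m (1 + g d)\<close>.\<close>

lemma inverse_multipliers_step:
  assumes g: "inverse_multipliers m g" and small: "norm (g * d) < 1"
  shows "\<exists>g'. inverse_multipliers (m + d) g'"
proof -
  define x where "x = - (g * d)"
  have "norm x < 1" using small by (simp add: x_def)
  then obtain y where "quasi_inverse x y" using quasi_inverse_exists by blast
  note y = quasi_inverseD[OF this]
  have mg: "m * g = mult_unit" "g * m = mult_unit" using g by (auto simp: inverse_multipliers_def)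
  have md: "m + d = m * (mult_unit - x)"
    by (simp add: x_def distrib_left mg flip: mult.assoc)
  have u: "(mult_unit - x) * (mult_unit + y) = mult_unit" "(mult_unit + y) * (mult_unit - x) = mult_unit"
    by (simp_all add: algebra_simps y)
  have "(m + d) * ((mult_unit + y) * g) = m * ((mult_unit - x) * (mult_unit + y)) * g"
    by (simp only: md mult.assoc)
  moreover have "((mult_unit + y) * g) * (m + d) = (mult_unit + y) * (g * m) * (mult_unit - x)"
    by (simp only: md mult.assoc)
  ultimately have "inverse_multipliers (m + d) ((mult_unit + y) * g)"
    by (simp add: inverse_multipliers_def u mg del: distrib_right)
  then show ?thesis ..
qed

text \<open>Self-adjoint elements have real spectrum. Moving from \<open>1\<close> to \<open>1 + i s H\<close> in equal steps of norm
  below \<open>1\<close>, invertibility survives each step because the preceding inverse has norm at most \<open>1\<close>.\<close>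

lemma inverse_imaginary_exists:
  assumes H: "star H = H"
  shows "\<exists>g. inverse_multipliers (mult_unit + Complex 0 s *\<^sub>C H) g"
proof -
  obtain N :: nat where N: "\<bar>s\<bar> * norm H < N"
    using reals_Archimedean2 by blast
  moreover have "0 \<le> \<bar>s\<bar> * norm H" by simp
  ultimately have "0 < N" by linarith
  define d where "d = s / N"
  have "\<exists>g. inverse_multipliers (mult_unit + Complex 0 (real n * d) *\<^sub>C H) g" for n
  proof (induction n)
    case 0
    have "Complex 0 0 *\<^sub>C H = 0" using norm_scaleC[of 0 H] by (simp add: zero_complex.code[symmetric])
    then show ?case by (auto simp: inverse_multipliers_def intro!: exI[of _ mult_unit])
  next
    case (Suc n)
    then obtain g where g: "inverse_multipliers (mult_unit + Complex 0 (real n * d) *\<^sub>C H) g" by blast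
    have "norm (g * Complex 0 d *\<^sub>C H) \<le> norm g * norm (Complex 0 d *\<^sub>C H)"
      by (rule norm_mult_ineq)
    also have "\<dots> \<le> 1 * norm (Complex 0 d *\<^sub>C H)"
      by (intro mult_right_mono norm_inverse_imaginary_le[OF H g]) simp
    also have "\<dots> = \<bar>s\<bar> * norm H / N"
      by (simp add: norm_scaleC d_def cmod_def)
    also have "\<dots> < 1" using N \<open>0 < N\<close> by simp
    finally obtain g' where
      "inverse_multipliers (mult_unit + Complex 0 (real n * d) *\<^sub>C H + Complex 0 d *\<^sub>C H) g'"
      using inverse_multipliers_step[OF g] by blast
    moreover have "Complex 0 (real (Suc n) * d) = Complex 0 (real n * d) + Complex 0 d"
      by (simp add: complex_eq_iff algebra_simps)
    ultimately show ?case by (auto simp: scaleC_add_left add.assoc)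
  qed
  from this[of N] \<open>0 < N\<close> show ?thesis by (simp add: d_def)
qed

text \<open>With \<open>h = c\<^sup>* c\<close> and \<open>p = (1 + i s h)\<^bsup>-1\<^esup>\<close>, the element \<open>1 - p = i s h p\<close> lies in the algebra and has
  norm at most \<open>2\<close>. Therefore \<open>\<parallel>c p\<parallel>\<^sup>2 = \<parallel>p\<^sup>* h p\<parallel> \<le> \<parallel>h p\<parallel> \<le> 2 / s\<close>.\<close>

lemma approximate_unit_single:
  fixes c :: "'a::cstar_algebra"
  assumes "0 < e"
  shows "\<exists>p. norm p \<le> 1 \<and> mult_unit - p \<in> range embed \<and> norm (c \<cdot>\<^sub>R p) < e"
proof -
  define h where "h = star c * c"
  obtain s :: nat where "2 / e\<^sup>2 < real s" using reals_Archimedean2 by blast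
  moreover have "0 < 2 / e\<^sup>2" using assms by simp
  ultimately have s0: "0 < real s" by linarith
  with \<open>2 / e\<^sup>2 < real s\<close> have s: "2 / real s < e\<^sup>2" "0 < real s"
    using assms by (auto simp: s0 field_simps)
  let ?i = "Complex 0 (real s)"
  have H: "star (embed h) = embed h" by (simp add: star_embed h_def star_mult star_star)
  obtain p where p: "inverse_multipliers (mult_unit + ?i *\<^sub>C embed h) p"
    using inverse_imaginary_exists[OF H] by blast
  have np: "norm p \<le> 1" by (rule norm_inverse_imaginary_le[OF H p])
  have "p + ?i *\<^sub>C embed h * p = mult_unit"
    using p by (simp add: inverse_multipliers_def distrib_right)
  then have up: "mult_unit - p = embed (?i *\<^sub>C (h \<cdot>\<^sub>R p))"
    by (simp add: embed_linear embed_ideal mult_scaleC_left algebra_simps)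
  have "norm (embed (?i *\<^sub>C (h \<cdot>\<^sub>R p))) \<le> 2"
    using norm_triangle_le_diff[OF order_trans[OF add_mono[OF norm_mult_unit_le np]], of 2]
    by (simp flip: up)
  then have "norm (?i *\<^sub>C (h \<cdot>\<^sub>R p)) \<le> 2"
    by (rule order_trans[OF norm_le_norm_embed])
  then have hp: "norm (h \<cdot>\<^sub>R p) \<le> 2 / s"
    using s by (simp add: norm_scaleC cmod_def field_simps)
  let ?z = "c \<cdot>\<^sub>R p"
  have "(norm ?z)\<^sup>2 = norm ((star p \<cdot>\<^sub>L star c) * ?z)"
    by (simp add: multiplier_star star_star flip: cstar_identity)
  also have "\<dots> = norm (star p \<cdot>\<^sub>L (h \<cdot>\<^sub>R p))"
    by (simp add: h_def mult_left_mult mult_right_mult)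
  also have "\<dots> \<le> norm (star p) * norm (h \<cdot>\<^sub>R p)" by (rule norm_multiplier_left)
  also have "\<dots> \<le> 1 * (2 / s)" using np hp by (intro mult_mono) (auto simp: norm_star)
  also have "\<dots> < e\<^sup>2" using s by simp
  finally have "norm ?z < e" using assms by (simp add: power2_less_imp_less)
  with np up show ?thesis by blast
qed

text \<open>The complements \<open>p\<close> of approximate units are contractions, so the case of several elements follows
  by multiplying them: the next factor is chosen for the image \<open>c p\<close> of the next element, and does
  not enlarge what earlier factors made small.\<close>

lemma approximate_unit:
  fixes F :: "'a::cstar_algebra set"
  assumes "finite F" "0 < e"
  shows "\<exists>p. norm p \<le> 1 \<and> mult_unit - p \<in> range embed \<and> (\<forall>c\<in>F. norm (c \<cdot>\<^sub>R p) < e)"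
  using assms(1)
proof induction
  case empty
  have "embed 0 = 0" by (rule multiplier_eqI) (simp add: embed multiplier_zero)
  then show ?case by (intro exI[of _ mult_unit]) (auto simp: norm_mult_unit_le image_iff intro!: exI[of _ 0])
next
  case (insert c F)
  then obtain p a where p: "norm p \<le> 1" "mult_unit - p = embed a" "\<forall>c\<in>F. norm (c \<cdot>\<^sub>R p) < e"
    by blast
  obtain q b where q: "norm q \<le> 1" "mult_unit - q = embed b" "norm ((c \<cdot>\<^sub>R p) \<cdot>\<^sub>R q) < e"
    using approximate_unit_single[OF assms(2), of "c \<cdot>\<^sub>R p"] by blast
  have "norm (p * q) \<le> 1"
    using norm_mult_ineq[of p q] mult_le_one[OF p(1) norm_ge_zero q(1)] by simp
  moreover have "mult_unit - p * q = embed (a + (p \<cdot>\<^sub>L b))"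
    by (simp add: embed_linear flip: p(2) embed_ideal q(2)) (simp add: algebra_simps)
  moreover have "norm ((d \<cdot>\<^sub>R p) \<cdot>\<^sub>R q) < e" if "d \<in> F" for d
  proof -
    have "norm ((d \<cdot>\<^sub>R p) \<cdot>\<^sub>R q) \<le> norm q * norm (d \<cdot>\<^sub>R p)" by (rule norm_multiplier_right)
    also have "\<dots> \<le> 1 * norm (d \<cdot>\<^sub>R p)" using q by (intro mult_right_mono) auto
    also have "\<dots> < e" using p that by simp
    finally show ?thesis .
  qed
  ultimately show ?case using q by (intro exI[of _ "p * q"]) (auto simp: multiplier_mult)
qed

section \<open>The strict topology and extensions of automorphisms\<close>

lemma topspace_strict [simp]: "topspace strict_topology = UNIV"
proof -
  have "m \<in> topspace strict_topology" for m :: "'a multiplier"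
    unfolding strict_topology_def topology_generated_by_topspace
  proof (rule UnionI)
    show "{n. norm ((n - m) \<cdot>\<^sub>L 0) < 1} \<in> {{n. norm ((n - m) \<cdot>\<^sub>L b) < e} | m b e. e > 0} \<union>
      {{n. norm (b \<cdot>\<^sub>R (n - m)) < e} | m b e. e > 0}"
      by (intro UnI1 CollectI exI[of _ m] exI[of _ 0] exI[of _ "1::real"] conjI refl) simp
  qed (simp add: multiplier_zero)
  then show ?thesis by blast
qed

definition strict_ball :: "'a::cstar_algebra multiplier \<Rightarrow> 'a set \<Rightarrow> real \<Rightarrow> 'a multiplier set" where
  "strict_ball m F e = {n. \<forall>b\<in>F. norm ((n - m) \<cdot>\<^sub>L b) < e \<and> norm (b \<cdot>\<^sub>R (n - m)) < e}"

lemma strict_ball_antimono: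
  "F \<subseteq> G \<Longrightarrow> d \<le> e \<Longrightarrow> strict_ball m G d \<subseteq> strict_ball m F e"
  unfolding strict_ball_def by force

lemma strict_ball_subset_openin:
  assumes "openin strict_topology U" "m \<in> U"
  shows "\<exists>F e. finite F \<and> 0 < e \<and> strict_ball m F e \<subseteq> U"
proof -
  let ?S = "{{n. norm ((n - m) \<cdot>\<^sub>L b) < e} | m b e. e > 0} \<union> {{n. norm (b \<cdot>\<^sub>R (n - m)) < e} | m b e. e > 0}
    :: 'a multiplier set set"
  have "generate_topology_on ?S U"
    using assms(1) by (simp add: strict_topology_def openin_topology_generated_by_iff)
  then show ?thesis
    using assms(2)
  proof induction
    case (Int A B)
    then obtain F e G d where FG: "finite F" "0 < e" "finite G" "0 < d"
      "strict_ball m F e \<subseteq> A" "strict_ball m G d \<subseteq> B" by auto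
    have "strict_ball m (F \<union> G) (min e d) \<subseteq> A \<inter> B"
      using strict_ball_antimono[of F "F \<union> G" "min e d" e m]
        strict_ball_antimono[of G "F \<union> G" "min e d" d m] FG(5,6) by auto
    then show ?case
      using FG by (intro exI[of _ "F \<union> G"] exI[of _ "min e d"]) simp
  next
    case (UN K)
    then obtain A where "A \<in> K" "m \<in> A" by blast
    with UN.IH[of A] show ?case by blast
  next
    case (Basis A)
    then consider (l) m0 b e where "A = {n. norm ((n - m0) \<cdot>\<^sub>L b) < e}"
      | (r) m0 b e where "A = {n. norm (b \<cdot>\<^sub>R (n - m0)) < e}" by blast
    then show ?case
    proof cases
      case l
      have "n \<in> A" if "norm ((n - m) \<cdot>\<^sub>L b) < e - norm ((m - m0) \<cdot>\<^sub>L b)" for n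
        using norm_triangle_ineq[of "(n - m) \<cdot>\<^sub>L b" "(m - m0) \<cdot>\<^sub>L b"] that
        by (simp add: l flip: multiplier_add)
      then have "strict_ball m {b} (e - norm ((m - m0) \<cdot>\<^sub>L b)) \<subseteq> A"
        by (auto simp: strict_ball_def)
      then show ?thesis
        using Basis.prems by (intro exI[of _ "{b}"] exI[of _ "e - norm ((m - m0) \<cdot>\<^sub>L b)"]) (simp add: l)
    next
      case r
      have "n \<in> A" if "norm (b \<cdot>\<^sub>R (n - m)) < e - norm (b \<cdot>\<^sub>R (m - m0))" for n
        using norm_triangle_ineq[of "b \<cdot>\<^sub>R (n - m)" "b \<cdot>\<^sub>R (m - m0)"] that
        by (simp add: r flip: multiplier_add)
      then have "strict_ball m {b} (e - norm (b \<cdot>\<^sub>R (m - m0))) \<subseteq> A"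
        by (auto simp: strict_ball_def)
      then show ?thesis
        using Basis.prems by (intro exI[of _ "{b}"] exI[of _ "e - norm (b \<cdot>\<^sub>R (m - m0))"]) (simp add: r)
    qed
  qed simp
qed

lemma openin_strict_seminorm:
  assumes "0 < e"
  shows "openin strict_topology {n. norm ((n - m) \<cdot>\<^sub>L b) < e}"
    "openin strict_topology {n. norm (b \<cdot>\<^sub>R (n - m)) < e}"
  using assms unfolding strict_topology_def by (blast intro: topology_generated_by_Basis)+

lemma limitin_strict_iff:
  "limitin strict_topology x m F \<longleftrightarrow>
    (\<forall>b. ((\<lambda>i. x i \<cdot>\<^sub>L b) \<longlongrightarrow> m \<cdot>\<^sub>L b) F \<and> ((\<lambda>i. b \<cdot>\<^sub>R x i) \<longlongrightarrow> b \<cdot>\<^sub>R m) F)"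
proof (intro iffI allI conjI tendstoI)
  fix b and e :: real
  assume lim: "limitin strict_topology x m F" and "0 < e"
  from limitinD[OF lim openin_strict_seminorm(1)[OF \<open>0 < e\<close>, of m b]]
  show "\<forall>\<^sub>F i in F. dist (x i \<cdot>\<^sub>L b) (m \<cdot>\<^sub>L b) < e"
    using \<open>0 < e\<close> by (simp add: multiplier_diff dist_norm)
  from limitinD[OF lim openin_strict_seminorm(2)[OF \<open>0 < e\<close>, of b m]]
  show "\<forall>\<^sub>F i in F. dist (b \<cdot>\<^sub>R x i) (b \<cdot>\<^sub>R m) < e"
    using \<open>0 < e\<close> by (simp add: multiplier_diff dist_norm)
next
  assume lim: "\<forall>b. ((\<lambda>i. x i \<cdot>\<^sub>L b) \<longlongrightarrow> m \<cdot>\<^sub>L b) F \<and> ((\<lambda>i. b \<cdot>\<^sub>R x i) \<longlongrightarrow> b \<cdot>\<^sub>R m) F"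
  show "limitin strict_topology x m F"
    unfolding limitin_def
  proof (intro conjI allI impI)
    fix U assume "openin strict_topology U \<and> m \<in> U"
    then obtain B e where B: "finite B" "0 < e" "strict_ball m B e \<subseteq> U"
      using strict_ball_subset_openin by blast
    have "\<forall>\<^sub>F i in F. x i \<in> strict_ball m B e"
      using lim B(1,2) by (simp add: strict_ball_def eventually_ball_finite_distrib multiplier_diff
          tendsto_iff dist_norm eventually_conj_iff)
    then show "\<forall>\<^sub>F i in F. x i \<in> U"
      by eventually_elim (use B(3) in blast)
  qed simp
qed

lemma Hausdorff_space_strict: "Hausdorff_space strict_topology"
  unfolding Hausdorff_space_def
proof (intro allI impI, elim conjE)
  fix m n :: "'a multiplier"
  assume "m \<noteq> n"
  then obtain b where "m \<cdot>\<^sub>L b \<noteq> n \<cdot>\<^sub>L b" using multiplier_eqI by blast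
  define e where "e = dist (m \<cdot>\<^sub>L b) (n \<cdot>\<^sub>L b) / 2"
  with \<open>m \<cdot>\<^sub>L b \<noteq> n \<cdot>\<^sub>L b\<close> have e: "e = dist (m \<cdot>\<^sub>L b) (n \<cdot>\<^sub>L b) / 2" "0 < e"
    by (simp_all only: zero_less_dist_iff half_gt_zero_iff not_False_eq_True)
  show "\<exists>U V. openin strict_topology U \<and> openin strict_topology V \<and> m \<in> U \<and> n \<in> V \<and> disjnt U V"
  proof (intro exI conjI)
    show "disjnt {k. norm ((k - m) \<cdot>\<^sub>L b) < e} {k. norm ((k - n) \<cdot>\<^sub>L b) < e}"
      unfolding disjnt_iff
    proof (intro allI notI, elim conjE CollectE)
      fix k assume "norm ((k - m) \<cdot>\<^sub>L b) < e" "norm ((k - n) \<cdot>\<^sub>L b) < e"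
      then show False
        using dist_triangle3[of "m \<cdot>\<^sub>L b" "n \<cdot>\<^sub>L b" "k \<cdot>\<^sub>L b"] e by (simp add: multiplier_diff dist_norm)
    qed
  qed (use e in \<open>auto simp: multiplier_zero intro: openin_strict_seminorm\<close>)
qed

text \<open>Let \<open>p\<close> and \<open>g\<close> be complements of approximate units for the right and the left action. The element
  \<open>m - p m g = (1 - p) m + p m (1 - g)\<close> lies in the algebra because the algebra is an ideal. The error
  \<open>p m g\<close> is small on both sides at once: multiplication by \<open>b\<close> from the left is absorbed by \<open>p\<close>, from
  the right by \<open>g\<close>.\<close>

lemma strict_closure_of_embed: "strict_topology closure_of (range embed) = UNIV"
proof -
  have "\<exists>k\<in>range embed. k \<in> U" if mU: "m \<in> U" and U: "openin strict_topology U" for m :: "'a multiplier" and U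
  proof -
    obtain F e where F: "finite F" "0 < e" "strict_ball m F e \<subseteq> U"
      using strict_ball_subset_openin[OF U mU] by blast
    define d where "d = e / (norm m + 1)"
    have d: "0 < d" "norm m * d < e"
      using F(2) by (simp_all add: d_def add_nonneg_pos pos_divide_less_eq distrib_left mult.commute)
    obtain p a where p: "norm p \<le> 1" "mult_unit - p = embed a" "\<forall>c\<in>F. norm (c \<cdot>\<^sub>R p) < d"
      using approximate_unit[OF F(1) d(1)] by blast
    obtain q a' where q: "norm q \<le> 1" "mult_unit - q = embed a'" "\<forall>c\<in>star ` F. norm (c \<cdot>\<^sub>R q) < d"
      using approximate_unit[OF finite_imageI[OF F(1)] d(1)] by blast
    \<comment> \<open>Taking adjoints turns a right approximate unit for the adjoints of \<open>F\<close> into a left one for \<open>F\<close>.\<close>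
    define g where "g = star q"
    have g: "norm g \<le> 1" "mult_unit - g = embed (star a')" "\<forall>c\<in>F. norm (g \<cdot>\<^sub>L c) < d"
    proof -
      show "norm g \<le> 1" using q by (simp add: g_def norm_star)
      have "star (mult_unit - q) + g = mult_unit" by (simp add: g_def flip: star_add)
      then show "mult_unit - g = embed (star a')" by (simp add: q star_embed algebra_simps)
      show "\<forall>c\<in>F. norm (g \<cdot>\<^sub>L c) < d" using q(3) by (simp add: g_def multiplier_star norm_star)
    qed
    define k where "k = m - p * m * g"
    have "k = (mult_unit - p) * m + p * m * (mult_unit - g)" by (simp add: k_def algebra_simps)
    then have k: "k = embed ((a \<cdot>\<^sub>R m) + ((p * m) \<cdot>\<^sub>L star a'))"
      by (simp add: p g embed_ideal embed_linear)
    have "k \<in> strict_ball m F e"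
      unfolding strict_ball_def
    proof (intro CollectI ballI)
      fix b assume b: "b \<in> F"
      have km: "k - m = - (p * (m * g))" by (simp add: k_def mult.assoc)
      have "norm ((k - m) \<cdot>\<^sub>L b) = norm (p \<cdot>\<^sub>L (m \<cdot>\<^sub>L (g \<cdot>\<^sub>L b)))"
        by (simp add: km multiplier_uminus multiplier_mult)
      also have "\<dots> \<le> norm p * (norm m * norm (g \<cdot>\<^sub>L b))"
        by (meson mult_left_mono norm_ge_zero norm_multiplier_left order_trans)
      also have "\<dots> \<le> 1 * (norm m * d)"
        using p g b by (intro mult_mono mult_left_mono) (auto intro: less_imp_le)
      finally have 1: "norm ((k - m) \<cdot>\<^sub>L b) < e" using d by simp
      have "norm (b \<cdot>\<^sub>R (k - m)) = norm (((b \<cdot>\<^sub>R p) \<cdot>\<^sub>R m) \<cdot>\<^sub>R g)"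
        by (simp add: km multiplier_uminus multiplier_mult)
      also have "\<dots> \<le> norm g * (norm m * norm (b \<cdot>\<^sub>R p))"
        by (meson mult_left_mono norm_ge_zero norm_multiplier_right order_trans)
      also have "\<dots> \<le> 1 * (norm m * d)"
        using p g b by (intro mult_mono mult_left_mono) (auto intro: less_imp_le)
      finally show "norm ((k - m) \<cdot>\<^sub>L b) < e \<and> norm (b \<cdot>\<^sub>R (k - m)) < e" using 1 d by simp
    qed
    with k F(3) show ?thesis by blast
  qed
  then show ?thesis by (auto simp: in_closure_of)
qed

lemma continuous_map_strictI:
  fixes f :: "'a::cstar_algebra multiplier \<Rightarrow> 'b::cstar_algebra multiplier"
  assumes "\<And>x m (F :: 'a multiplier filter). limitin strict_topology x m F \<Longrightarrow> limitin strict_topology (\<lambda>i. f (x i)) (f m) F"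
  shows "continuous_map strict_topology strict_topology f"
proof -
  have "limitin strict_topology (\<lambda>x. x) m (atin strict_topology m)" for m :: "'a multiplier"
    using continuous_map_id[of "strict_topology :: 'a multiplier topology", unfolded continuous_map_atin id_def] by simp
  then show ?thesis
    by (simp add: continuous_map_atin assms)
qed

text \<open>The map \<open>m \<mapsto> \<phi> \<circ> m \<circ> inv \<phi>\<close> is a strictly continuous extension, and by density of the algebra in a
  Hausdorff space it is the only one, so the definite description denotes it.\<close>

lemma strict_extension_apply:
  assumes \<phi>: "star_automorphism \<phi>"
  shows "strict_extension \<phi> m \<cdot>\<^sub>L b = \<phi> (m \<cdot>\<^sub>L inv \<phi> b)"
    "b \<cdot>\<^sub>R strict_extension \<phi> m = \<phi> (inv \<phi> b \<cdot>\<^sub>R m)"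
proof -
  note r = star_automorphism_rules[OF \<phi>] and ri = star_automorphism_rules[OF star_automorphism_inv[OF \<phi>]]
  have i: "inv \<phi> (\<phi> x) = x" "\<phi> (inv \<phi> x) = x" for x
    using r(6) by (simp_all add: bij_is_inj bij_is_surj surj_f_inv_f)
  note bl = bounded_linear_star_automorphism[OF \<phi>]
    and bli = bounded_linear_star_automorphism[OF star_automorphism_inv[OF \<phi>]]
  define E where "E m = make_multiplier (\<lambda>b. \<phi> (m \<cdot>\<^sub>L inv \<phi> b)) (\<lambda>b. \<phi> (inv \<phi> b \<cdot>\<^sub>R m))" for m
  note bll = bounded_linear_compose[OF bl bounded_linear_compose[OF bounded_linear_multiplier_left bli]]
    and blr = bounded_linear_compose[OF bl bounded_linear_compose[OF bounded_linear_multiplier_right bli]]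
  have adj: "\<phi> (inv \<phi> a \<cdot>\<^sub>R m) * b = a * \<phi> (m \<cdot>\<^sub>L inv \<phi> b)" for m a b
    by (metis i mult_right_left r(4))
  have E: "E m \<cdot>\<^sub>L b = \<phi> (m \<cdot>\<^sub>L inv \<phi> b)" "b \<cdot>\<^sub>R E m = \<phi> (inv \<phi> b \<cdot>\<^sub>R m)" for m b
    unfolding E_def by (subst make_multiplier; simp add: bll blr adj multiplier_rules r ri i)+
  have cont: "continuous_map strict_topology strict_topology E"
  proof (rule continuous_map_strictI)
    fix x :: "'a multiplier \<Rightarrow> 'a multiplier" and m F
    assume "limitin strict_topology x m F"
    then show "limitin strict_topology (\<lambda>i. E (x i)) (E m) F"
      by (simp add: limitin_strict_iff E bounded_linear.tendsto[OF bl])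
  qed
  have emb: "E (embed a) = embed (\<phi> a)" for a
    by (rule multiplier_eqI) (simp add: E embed r i)
  have "strict_extension \<phi> = E"
    unfolding strict_extension_def
  proof (rule the_equality)
    fix \<psi> assume \<psi>: "continuous_map strict_topology strict_topology \<psi> \<and> (\<forall>a. \<psi> (embed a) = embed (\<phi> a))"
    show "\<psi> = E"
    proof
      fix m
      show "\<psi> m = E m"
        by (rule forall_in_closure_of_eq[of m strict_topology "range embed" strict_topology])
          (use \<psi> cont emb in \<open>auto simp: strict_closure_of_embed Hausdorff_space_strict\<close>)
    qed
  qed (use cont emb in auto)
  then show "strict_extension \<phi> m \<cdot>\<^sub>L b = \<phi> (m \<cdot>\<^sub>L inv \<phi> b)"
    "b \<cdot>\<^sub>R strict_extension \<phi> m = \<phi> (inv \<phi> b \<cdot>\<^sub>R m)"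
    by (simp_all add: E)
qed


section \<open>The norm integral\<close>

abbreviation integrable_simple :: "'x measure \<Rightarrow> ('x \<Rightarrow> 'b::real_vector) \<Rightarrow> bool" where
  "integrable_simple \<equiv> Bochner_Integration.simple_bochner_integrable"

abbreviation integral_simple :: "'x measure \<Rightarrow> ('x \<Rightarrow> 'b::real_vector) \<Rightarrow> 'b" where
  "integral_simple \<equiv> Bochner_Integration.simple_bochner_integral"

text \<open>Without second countability, the difference of two Borel measurable functions need not be
  measurable. Its norm is measurable when one of them takes finitely many values, as it then splits
  into finitely many functions \<open>\<parallel>h(t) - y\<parallel>\<close>.\<close>

lemma borel_measurable_norm_diff_simple:
  fixes h :: "'x \<Rightarrow> 'b::real_normed_vector"
  assumes h: "h \<in> borel_measurable M" and s: "simple_function M s"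
  shows "(\<lambda>t. norm (h t - s t)) \<in> borel_measurable M"
proof -
  have [measurable]: "(\<lambda>t. norm (h t - y)) \<in> borel_measurable M" for y
    by (rule measurable_compose[OF h]) (intro borel_measurable_continuous_onI continuous_intros)
  have [measurable]: "s -` {y} \<inter> space M \<in> sets M" for y
    using s by (rule simple_functionD)
  have "norm (h t - s t) = (\<Sum>y\<in>s ` space M. indicator (s -` {y} \<inter> space M) t * norm (h t - y))"
    if "t \<in> space M" for t
  proof -
    have "(\<Sum>y\<in>s ` space M. indicator (s -` {y} \<inter> space M) t * norm (h t - y)) =
        (\<Sum>y\<in>s ` space M. if y = s t then norm (h t - y) else 0)"
      using that by (intro sum.cong) (auto simp: indicator_def)
    also have "\<dots> = norm (h t - s t)"
      using that simple_functionD(1)[OF s] by (simp add: sum.delta)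
    finally show ?thesis by simp
  qed
  then show ?thesis
    by (subst measurable_cong) (assumption, measurable)
qed

lemma simple_bochner_integrable_simple_function:
  "integrable_simple M s \<Longrightarrow> simple_function M s"
  by (auto elim: simple_bochner_integrable.cases)

lemma simple_bochner_integral_diff_bound:
  fixes h :: "'x \<Rightarrow> 'b::real_normed_vector"
  assumes h: "h \<in> borel_measurable M"
    and s: "integrable_simple M s" and s': "integrable_simple M s'"
  shows "ennreal (norm (integral_simple M s - integral_simple M s')) \<le>
    (\<integral>\<^sup>+t. norm (h t - s t) \<partial>M) + (\<integral>\<^sup>+t. norm (h t - s' t) \<partial>M)"
proof -
  have d: "integrable_simple M (\<lambda>t. s t - s' t)"
    by (rule simple_bochner_integrable_compose2[OF _ s s']) simp
  have "ennreal (norm (integral_simple M s - integral_simple M s')) =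
      norm (integral_simple M (\<lambda>t. s t - s' t))"
    by (simp add: simple_bochner_integral_diff s s')
  also have "\<dots> \<le> integral_simple M (\<lambda>t. norm (s t - s' t))"
    by (intro ennreal_leI simple_bochner_integral_norm_bound d)
  also have "\<dots> = (\<integral>\<^sup>+t. norm (s t - s' t) \<partial>M)"
    using simple_bochner_integrable_compose2[of "\<lambda>x y. norm (x - y)", OF _ s s']
    by (intro simple_bochner_integral_eq_nn_integral) auto
  also have "\<dots> \<le> (\<integral>\<^sup>+t. ennreal (norm (h t - s t)) + ennreal (norm (h t - s' t)) \<partial>M)"
  proof (intro nn_integral_mono)
    fix t
    have "norm (s t - s' t) \<le> norm (h t - s t) + norm (h t - s' t)"
      using norm_triangle_ineq4[of "h t - s' t" "h t - s t"] by simp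
    then show "ennreal (norm (s t - s' t)) \<le> ennreal (norm (h t - s t)) + ennreal (norm (h t - s' t))"
      by (simp flip: ennreal_plus)
  qed
  also have "\<dots> = (\<integral>\<^sup>+t. norm (h t - s t) \<partial>M) + (\<integral>\<^sup>+t. norm (h t - s' t) \<partial>M)"
    using borel_measurable_norm_diff_simple[OF h simple_bochner_integrable_simple_function] s s'
    by (intro nn_integral_add) (auto intro!: measurable_compose[OF _ measurable_ennreal])
  finally show ?thesis .
qed

lemma has_norm_integralE:
  assumes "has_norm_integral M h x"
  obtains s where "h \<in> borel_measurable M" "\<And>i. integrable_simple M (s i)"
    "(\<lambda>i. \<integral>\<^sup>+t. ennreal (norm (h t - s i t)) \<partial>M) \<longlonglongrightarrow> 0"
    "(\<lambda>i. integral_simple M (s i)) \<longlonglongrightarrow> x"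
  using assms unfolding has_norm_integral_def by blast

lemma has_norm_integralI:
  assumes "h \<in> borel_measurable M" "\<And>i. integrable_simple M (s i)"
    "(\<lambda>i. \<integral>\<^sup>+t. ennreal (norm (h t - s i t)) \<partial>M) \<longlonglongrightarrow> 0"
    "(\<lambda>i. integral_simple M (s i)) \<longlonglongrightarrow> x"
  shows "has_norm_integral M h x"
  using assms unfolding has_norm_integral_def by blast

lemma tendsto_zero_of_ennreal_norm_le:
  assumes "\<And>i. ennreal (norm (u i)) \<le> v i" "(v \<longlongrightarrow> 0) F"
  shows "(u \<longlongrightarrow> 0) F"
proof -
  have "((\<lambda>i. ennreal (norm (u i))) \<longlongrightarrow> 0) F"
    by (rule tendsto_sandwich[OF _ _ tendsto_const assms(2)]) (use assms(1) in auto)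
  then show ?thesis
    using tendsto_ennreal_iff[of "\<lambda>i. norm (u i)" F 0] by (simp add: tendsto_norm_zero_iff)
qed

lemma has_norm_integral_unique:
  assumes "has_norm_integral M h x" "has_norm_integral M h y"
  shows "x = y"
proof -
  obtain s where h: "h \<in> borel_measurable M" and s: "\<And>i. integrable_simple M (s i)"
    "(\<lambda>i. \<integral>\<^sup>+t. ennreal (norm (h t - s i t)) \<partial>M) \<longlonglongrightarrow> 0"
    "(\<lambda>i. integral_simple M (s i)) \<longlonglongrightarrow> x"
    using assms(1) by (rule has_norm_integralE) (rule that)
  obtain r where r: "\<And>i. integrable_simple M (r i)"
    "(\<lambda>i. \<integral>\<^sup>+t. ennreal (norm (h t - r i t)) \<partial>M) \<longlonglongrightarrow> 0"
    "(\<lambda>i. integral_simple M (r i)) \<longlonglongrightarrow> y"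
    using assms(2) by (rule has_norm_integralE) (rule that)
  have "(\<lambda>i. integral_simple M (s i) - integral_simple M (r i)) \<longlonglongrightarrow> 0"
    by (rule tendsto_zero_of_ennreal_norm_le[OF simple_bochner_integral_diff_bound[OF h s(1) r(1)]])
      (use tendsto_add[OF s(2) r(2)] in simp)
  from LIMSEQ_unique[OF this tendsto_diff[OF s(3) r(3)]] show ?thesis by simp
qed

lemma has_norm_integral_norm_le:
  assumes "has_norm_integral M h x"
  shows "ennreal (norm x) \<le> (\<integral>\<^sup>+t. norm (h t) \<partial>M)"
proof -
  obtain s where h: "h \<in> borel_measurable M" and s: "\<And>i. integrable_simple M (s i)"
    "(\<lambda>i. \<integral>\<^sup>+t. ennreal (norm (h t - s i t)) \<partial>M) \<longlonglongrightarrow> 0"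
    "(\<lambda>i. integral_simple M (s i)) \<longlonglongrightarrow> x"
    using assms(1) by (rule has_norm_integralE) (rule that)
  have z: "integrable_simple M (\<lambda>_. 0)" "integral_simple M (\<lambda>_. 0) = (0::'b)"
    by (auto simp: simple_bochner_integrable.simps simple_bochner_integral_def image_constant_conv)
  have le: "ennreal (norm (integral_simple M (s i))) \<le>
      (\<integral>\<^sup>+t. norm (h t - s i t) \<partial>M) + (\<integral>\<^sup>+t. norm (h t) \<partial>M)" for i
    using simple_bochner_integral_diff_bound[OF h s(1)[of i] z(1)] by (simp add: z)
  have lim: "(\<lambda>i. ennreal (norm (integral_simple M (s i)))) \<longlonglongrightarrow> ennreal (norm x)"
    by (intro tendsto_ennrealI tendsto_norm s(3))
  have lim': "(\<lambda>i. (\<integral>\<^sup>+t. norm (h t - s i t) \<partial>M) + (\<integral>\<^sup>+t. norm (h t) \<partial>M)) \<longlonglongrightarrow> 0 + (\<integral>\<^sup>+t. norm (h t) \<partial>M)"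
    by (rule tendsto_add[OF s(2) tendsto_const])
  have "ennreal (norm x) \<le> 0 + (\<integral>\<^sup>+t. norm (h t) \<partial>M)"
    by (rule LIMSEQ_le[OF lim lim']) (simp only: le simp_thms)
  then show ?thesis by simp
qed

text \<open>Measurability of the sum has to be assumed, since it is not automatic for range types that are not
  second countable; here it will follow from continuity.\<close>

lemma has_norm_integral_add:
  assumes "has_norm_integral M h x" "has_norm_integral M k y"
    and m: "(\<lambda>t. h t + k t) \<in> borel_measurable M"
  shows "has_norm_integral M (\<lambda>t. h t + k t) (x + y)"
proof -
  obtain s where h: "h \<in> borel_measurable M" and s: "\<And>i. integrable_simple M (s i)"
    "(\<lambda>i. \<integral>\<^sup>+t. ennreal (norm (h t - s i t)) \<partial>M) \<longlonglongrightarrow> 0"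
    "(\<lambda>i. integral_simple M (s i)) \<longlonglongrightarrow> x"
    using assms(1) by (rule has_norm_integralE) (rule that)
  obtain r where k: "k \<in> borel_measurable M" and r: "\<And>i. integrable_simple M (r i)"
    "(\<lambda>i. \<integral>\<^sup>+t. ennreal (norm (k t - r i t)) \<partial>M) \<longlonglongrightarrow> 0"
    "(\<lambda>i. integral_simple M (r i)) \<longlonglongrightarrow> y"
    using assms(2) by (rule has_norm_integralE) (rule that)
  note m' = borel_measurable_norm_diff_simple[OF h simple_bochner_integrable_simple_function[OF s(1)]]
    borel_measurable_norm_diff_simple[OF k simple_bochner_integrable_simple_function[OF r(1)]]
  show ?thesis
  proof (rule has_norm_integralI[where s = "\<lambda>i t. s i t + r i t", OF m])
    show "integrable_simple M (\<lambda>t. s i t + r i t)" for i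
      by (rule simple_bochner_integrable_compose2[OF _ s(1) r(1)]) simp
    show "(\<lambda>i. integral_simple M (\<lambda>t. s i t + r i t)) \<longlonglongrightarrow> x + y"
      using tendsto_add[OF s(3) r(3)] by (simp add: simple_bochner_integral_add s(1) r(1))
    have "(\<integral>\<^sup>+t. norm (h t + k t - (s i t + r i t)) \<partial>M) \<le>
        (\<integral>\<^sup>+t. norm (h t - s i t) \<partial>M) + (\<integral>\<^sup>+t. norm (k t - r i t) \<partial>M)" for i
    proof -
      have "(\<integral>\<^sup>+t. norm (h t + k t - (s i t + r i t)) \<partial>M) \<le>
          (\<integral>\<^sup>+t. ennreal (norm (h t - s i t)) + ennreal (norm (k t - r i t)) \<partial>M)"
        by (intro nn_integral_mono) (simp add: norm_diff_triangle_ineq flip: ennreal_plus)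
      also have "\<dots> = (\<integral>\<^sup>+t. norm (h t - s i t) \<partial>M) + (\<integral>\<^sup>+t. norm (k t - r i t) \<partial>M)"
        by (intro nn_integral_add measurable_compose[OF _ measurable_ennreal] m')
      finally show ?thesis .
    qed
    note le = this
    have "(\<lambda>i. (\<integral>\<^sup>+t. norm (h t - s i t) \<partial>M) + (\<integral>\<^sup>+t. norm (k t - r i t) \<partial>M)) \<longlonglongrightarrow> 0"
      using tendsto_add[OF s(2) r(2)] by (simp only: add_0)
    from tendsto_sandwich[OF always_eventually always_eventually tendsto_const this, OF allI allI, OF zero_le le]
    show "(\<lambda>i. \<integral>\<^sup>+t. ennreal (norm (h t + k t - (s i t + r i t))) \<partial>M) \<longlonglongrightarrow> 0" .
  qed
qed

lemma has_norm_integral_bounded_linear: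
  assumes T: "bounded_linear T" and "has_norm_integral M h x"
  shows "has_norm_integral M (\<lambda>t. T (h t)) (T x)"
proof -
  obtain s where h: "h \<in> borel_measurable M" and s: "\<And>i. integrable_simple M (s i)"
    "(\<lambda>i. \<integral>\<^sup>+t. ennreal (norm (h t - s i t)) \<partial>M) \<longlonglongrightarrow> 0"
    "(\<lambda>i. integral_simple M (s i)) \<longlonglongrightarrow> x"
    using assms(2) by (rule has_norm_integralE) (rule that)
  interpret T: bounded_linear T by (rule T)
  obtain K where K: "0 \<le> K" "\<And>v. norm (T v) \<le> norm v * K"
    using T.nonneg_bounded by blast
  note m' = borel_measurable_norm_diff_simple[OF h simple_bochner_integrable_simple_function[OF s(1)]]
  show ?thesis
  proof (rule has_norm_integralI[where s = "\<lambda>i t. T (s i t)"])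
    show "(\<lambda>t. T (h t)) \<in> borel_measurable M"
      by (rule measurable_compose[OF h])
        (intro borel_measurable_continuous_onI T.continuous_on continuous_on_id)
    show "integrable_simple M (\<lambda>t. T (s i t))" for i
      using simple_bochner_integrable_compose2[of "\<lambda>u v. T u", OF _ s(1) s(1)] T.zero by simp
    show "(\<lambda>i. integral_simple M (\<lambda>t. T (s i t))) \<longlonglongrightarrow> T x"
      using T.tendsto[OF s(3)] by (simp add: simple_bochner_integral_linear[OF T.linear_axioms s(1)])
    have "(\<integral>\<^sup>+t. norm (T (h t) - T (s i t)) \<partial>M) \<le> ennreal K * (\<integral>\<^sup>+t. norm (h t - s i t) \<partial>M)" for i
    proof -
      have "(\<integral>\<^sup>+t. norm (T (h t) - T (s i t)) \<partial>M) \<le> (\<integral>\<^sup>+t. ennreal K * norm (h t - s i t) \<partial>M)"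
        using K by (intro nn_integral_mono) (simp add: mult.commute flip: T.diff ennreal_mult)
      also have "\<dots> = ennreal K * (\<integral>\<^sup>+t. norm (h t - s i t) \<partial>M)"
        by (intro nn_integral_cmult measurable_compose[OF _ measurable_ennreal] m')
      finally show ?thesis .
    qed
    note le = this
    have "(\<lambda>i. ennreal K * (\<integral>\<^sup>+t. norm (h t - s i t) \<partial>M)) \<longlonglongrightarrow> 0"
      using ennreal_tendsto_cmult[OF _ s(2), of "ennreal K"] by simp
    from tendsto_sandwich[OF always_eventually always_eventually tendsto_const this, OF allI allI, OF zero_le le]
    show "(\<lambda>i. \<integral>\<^sup>+t. ennreal (norm (T (h t) - T (s i t))) \<partial>M) \<longlonglongrightarrow> 0" .
  qed
qed

lemma has_norm_integral_exists:
  fixes h :: "'x \<Rightarrow> 'b::banach"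
  assumes h: "h \<in> borel_measurable M"
    and approx: "\<And>e. 0 < e \<Longrightarrow> \<exists>s. integrable_simple M s \<and> (\<integral>\<^sup>+t. norm (h t - s t) \<partial>M) \<le> ennreal e"
  shows "\<exists>x. has_norm_integral M h x"
proof -
  have "\<exists>s. integrable_simple M s \<and> (\<integral>\<^sup>+t. norm (h t - s t) \<partial>M) \<le> ennreal (inverse (real (Suc n)))" for n
    by (rule approx) simp
  then obtain s where s: "\<And>n. integrable_simple M (s n)"
    "\<And>n. (\<integral>\<^sup>+t. norm (h t - s n t) \<partial>M) \<le> ennreal (inverse (real (Suc n)))"
    by metis
  let ?I = "\<lambda>n. integral_simple M (s n)"
  have "norm (?I m - ?I n) \<le> inverse (real (Suc m)) + inverse (real (Suc n))" for m n
  proof -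
    have "ennreal (norm (?I m - ?I n)) \<le> ennreal (inverse (real (Suc m))) + ennreal (inverse (real (Suc n)))"
      by (rule order_trans[OF simple_bochner_integral_diff_bound[OF h s(1) s(1)] add_mono[OF s(2) s(2)]])
    then show ?thesis by (simp flip: ennreal_plus)
  qed
  note I = this
  have "Cauchy ?I"
  proof (rule metric_CauchyI)
    fix e :: real assume "0 < e"
    then have "0 < e / 2" by simp
    then obtain N where N: "inverse (real (Suc N)) < e / 2" using reals_Archimedean by blast
    have "dist (?I m) (?I n) < e" if "N \<le> m" "N \<le> n" for m n
    proof -
      have "inverse (real (Suc k)) < e / 2" if "N \<le> k" for k
        by (rule le_less_trans[OF _ N]) (use that in \<open>simp add: le_imp_inverse_le\<close>)
      from this[OF that(1)] this[OF that(2)] I[of m n] show ?thesis by (simp add: dist_norm)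
    qed
    then show "\<exists>N. \<forall>m\<ge>N. \<forall>n\<ge>N. dist (?I m) (?I n) < e" by blast
  qed
  then obtain x where "?I \<longlonglongrightarrow> x" by (auto simp: Cauchy_convergent_iff convergent_def)
  moreover have "(\<lambda>n. \<integral>\<^sup>+t. norm (h t - s n t) \<partial>M) \<longlonglongrightarrow> 0"
  proof (rule tendsto_sandwich[OF _ _ tendsto_const[of 0]])
    show "(\<lambda>n. ennreal (inverse (real (Suc n)))) \<longlonglongrightarrow> 0"
      using tendsto_ennrealI[OF LIMSEQ_inverse_real_of_nat] by simp
  qed (use s(2) in auto)
  ultimately show ?thesis using has_norm_integralI[of h M s x, OF h s(1)] by blast
qed

section \<open>Integrability of dominated continuous functions\<close>

lemma regular_borel_measureD:
  assumes "regular_borel_measure \<mu>"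
  shows "sets \<mu> = sets borel" "compact K \<Longrightarrow> emeasure \<mu> K < \<infinity>"
    "open U \<Longrightarrow> emeasure \<mu> U = (SUP K\<in>{K. compact K \<and> K \<subseteq> U}. emeasure \<mu> K)"
  using assms by (simp_all only: regular_borel_measure_def)

text \<open>The set where \<open>|f|\<close> lies strictly between \<open>1/n\<close> and \<open>n\<close> is open and, by integrability, of finite
  measure, so inner regularity on open sets supplies a compact subset of nearly full measure. Since
  \<open>|f|\<close> is below \<open>n\<close> there, little of the integral is lost; the part outside the set tends to \<open>0\<close> as
  \<open>n\<close> grows.\<close>

lemma integral_concentrated_on_compact:
  fixes f :: "'x::t2_space \<Rightarrow> 'b::{banach, second_countable_topology}"
  assumes \<mu>: "regular_borel_measure \<mu>" and f: "continuous_on UNIV f" "integrable \<mu> f" and e: "0 < e"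
  shows "\<exists>K. compact K \<and> (\<integral>\<^sup>+t\<in>-K. norm (f t) \<partial>\<mu>) \<le> ennreal e"
proof -
  have sets[measurable_cong]: "sets \<mu> = sets borel" by (rule regular_borel_measureD[OF \<mu>])
  have [measurable]: "f \<in> borel_measurable \<mu>" using f(2) by auto
  have cn: "continuous_on UNIV (\<lambda>t. norm (f t))" using f(1) by (intro continuous_intros)
  have fin: "(\<integral>\<^sup>+t. norm (f t) \<partial>\<mu>) < \<infinity>" using f(2) by (simp add: integrable_iff_bounded)
  define V where "V n = {t. inverse (real (Suc n)) < norm (f t) \<and> norm (f t) < real (Suc n)}" for n
  have Vo: "open (V n)" for n
    unfolding V_def by (intro open_Collect_conj open_Collect_less cn continuous_on_const)
  then have [measurable]: "V n \<in> sets \<mu>" for n by (simp add: sets)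
  have "(\<lambda>n. \<integral>\<^sup>+t\<in>-V n. norm (f t) \<partial>\<mu>) \<longlonglongrightarrow> (\<integral>\<^sup>+t. 0 \<partial>\<mu>)"
  proof (rule nn_integral_dominated_convergence[where w = "\<lambda>t. ennreal (norm (f t))"])
    show "AE t in \<mu>. (\<lambda>n. ennreal (norm (f t)) * indicator (- V n) t) \<longlonglongrightarrow> 0"
    proof (intro AE_I2)
      fix t
      show "(\<lambda>n. ennreal (norm (f t)) * indicator (- V n) t) \<longlonglongrightarrow> 0"
      proof (cases "f t = 0")
        case False
        obtain N where N: "inverse (real (Suc N)) < norm (f t)"
          using False reals_Archimedean[of "norm (f t)"] by auto
        obtain N' where N': "norm (f t) < real N'" using reals_Archimedean2 by blast
        have "t \<in> V n" if "n \<ge> max N N'" for n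
        proof -
          have "inverse (real (Suc n)) \<le> inverse (real (Suc N))"
            using that by (intro le_imp_inverse_le) auto
          with N have "inverse (real (Suc n)) < norm (f t)" by (rule le_less_trans[rotated])
          then show ?thesis using that N' by (auto simp: V_def)
        qed
        then have "\<forall>\<^sub>F n in sequentially. ennreal (norm (f t)) * indicator (- V n) t = 0"
          by (intro eventually_sequentiallyI[of "max N N'"]) auto
        then show ?thesis by (rule tendsto_eventually)
      qed simp
    qed
    show "AE t in \<mu>. ennreal (norm (f t)) * indicator (- V n) t \<le> ennreal (norm (f t))" for n
      by (intro AE_I2) (simp add: indicator_def)
    show "(\<integral>\<^sup>+t. norm (f t) \<partial>\<mu>) < \<infinity>" by (rule fin)
  qed measurable
  then have "\<forall>\<^sub>F n in sequentially. (\<integral>\<^sup>+t\<in>-V n. norm (f t) \<partial>\<mu>) < ennreal (e / 2)"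
    using e by (intro order_tendstoD(2)[where y = 0]) auto
  then obtain n where n: "(\<integral>\<^sup>+t\<in>-V n. norm (f t) \<partial>\<mu>) < ennreal (e / 2)"
    using eventually_happens'[OF sequentially_bot] by blast
  have "ennreal (inverse (real (Suc n))) * emeasure \<mu> (V n) = (\<integral>\<^sup>+t. ennreal (inverse (real (Suc n))) * indicator (V n) t \<partial>\<mu>)"
    by (rule nn_integral_cmult_indicator[symmetric]) measurable
  also have "\<dots> \<le> (\<integral>\<^sup>+t. norm (f t) \<partial>\<mu>)"
    by (intro nn_integral_mono) (simp add: V_def indicator_def ennreal_leI del: of_nat_Suc)
  also note fin
  finally have Vfin: "emeasure \<mu> (V n) \<noteq> \<infinity>"
    by (intro notI) (simp add: ennreal_mult_top)
  define d where "d = e / (2 * real (Suc n))"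
  have d: "0 < d" "real (Suc n) * d = e / 2" using e by (simp_all add: d_def del: of_nat_Suc)
  have "\<exists>K\<in>{K. compact K \<and> K \<subseteq> V n}. emeasure \<mu> (V n) < emeasure \<mu> K + ennreal d"
  proof (rule SUP_approx_ennreal[OF d(1) _ _ Vfin])
    show "{K. compact K \<and> K \<subseteq> V n} \<noteq> {}" using compact_empty by blast
    show "emeasure \<mu> (V n) = (SUP K\<in>{K. compact K \<and> K \<subseteq> V n}. emeasure \<mu> K)"
      by (rule regular_borel_measureD(3)[OF \<mu> Vo])
  qed
  then obtain K where K: "compact K" "K \<subseteq> V n" "emeasure \<mu> (V n) < emeasure \<mu> K + ennreal d"
    by blast
  have [measurable]: "K \<in> sets \<mu>" using K(1) by (simp add: sets borel_closed compact_imp_closed)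
  have "emeasure \<mu> K \<noteq> \<infinity>" using regular_borel_measureD(2)[OF \<mu> K(1)] by simp
  then have "emeasure \<mu> (V n - K) = emeasure \<mu> (V n) - emeasure \<mu> K"
    using K(2) by (intro emeasure_Diff) simp_all
  also have "\<dots> \<le> ennreal d" using K(3) Vfin by (simp add: ennreal_minus_le_iff less_imp_le)
  finally have VK: "emeasure \<mu> (V n - K) \<le> ennreal d" .
  have "(\<integral>\<^sup>+t\<in>-K. norm (f t) \<partial>\<mu>) \<le>
      (\<integral>\<^sup>+t. ennreal (norm (f t)) * indicator (- V n) t + ennreal (real (Suc n)) * indicator (V n - K) t \<partial>\<mu>)"
    by (intro nn_integral_mono) (simp add: V_def indicator_def ennreal_leI del: of_nat_Suc)
  also have "\<dots> = (\<integral>\<^sup>+t\<in>-V n. norm (f t) \<partial>\<mu>) + ennreal (real (Suc n)) * emeasure \<mu> (V n - K)"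
    by (subst nn_integral_add) (auto simp: nn_integral_cmult_indicator)
  also have "\<dots> \<le> ennreal (e / 2) + ennreal (real (Suc n)) * ennreal d"
    using n VK by (intro add_mono mult_left_mono) auto
  also have "\<dots> = ennreal e"
    using d e by (simp flip: ennreal_mult ennreal_plus)
  finally show ?thesis using K(1) by blast
qed

lemma simple_approximation_finite_range:
  assumes "finite F" "h \<in> borel_measurable M" "K \<in> sets M" "emeasure M K < \<infinity>"
    and "\<And>t. t \<in> K \<Longrightarrow> \<exists>c\<in>F. norm (h t - c) < e"
  shows "\<exists>s. integrable_simple M s \<and> (\<forall>t\<in>K. norm (h t - s t) < e) \<and> (\<forall>t. t \<notin> K \<longrightarrow> s t = 0)"
  using assms
proof (induction F arbitrary: K)
  case empty
  then have "K = {}" by auto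
  then show ?case
    by (intro exI[of _ "\<lambda>_. 0"]) (auto simp: simple_bochner_integrable.simps)
next
  case (insert c F)
  have m: "(\<lambda>t. norm (h t - c)) \<in> borel_measurable M"
    by (rule measurable_compose[OF insert.prems(1)])
      (intro borel_measurable_continuous_onI continuous_intros)
  define N where "N = {t \<in> space M. norm (h t - c) < e} \<inter> K"
  have KS: "K \<subseteq> space M" using insert.prems(2) by (rule sets.sets_into_space)
  have N: "N \<in> sets M" unfolding N_def using insert.prems(2) m by measurable
  have Kdef: "K - N \<in> sets M" using N insert.prems(2) by blast
  have fin: "emeasure M (K - N) < \<infinity>"
    using emeasure_mono[of "K - N" K M] insert.prems(2,3) by (auto intro: le_less_trans)
  have "\<exists>c\<in>F. norm (h t - c) < e" if "t \<in> K - N" for t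
    using that insert.prems(4)[of t] KS by (auto simp: N_def)
  from insert.IH[OF insert.prems(1) Kdef fin this] obtain s where
    s: "integrable_simple M s" "\<forall>t\<in>K - N. norm (h t - s t) < e" "\<forall>t. t \<notin> K - N \<longrightarrow> s t = 0"
    by blast
  let ?s = "\<lambda>t. if t \<in> N then c else s t"
  have "simple_function M ?s"
    using s(1) N by (intro simple_function_If_set)
      (auto simp: sets.Int_space_eq2 simple_bochner_integrable.simps)
  moreover have "emeasure M {t \<in> space M. ?s t \<noteq> 0} \<le> emeasure M K"
    using s(3) insert.prems(2) by (intro emeasure_mono) (auto simp: N_def split: if_splits)
  then have "emeasure M {t \<in> space M. ?s t \<noteq> 0} \<noteq> \<infinity>"
    using insert.prems(3) by auto
  ultimately have "integrable_simple M ?s" by (rule simple_bochner_integrable.intros)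
  then show ?case
    using s(2,3) by (intro exI[of _ ?s]) (auto simp: N_def)
qed

text \<open>Almost all of the integral of the dominating function sits on a compact \<open>K\<close>, whose image under
  \<open>h\<close> is totally bounded; hence \<open>h\<close> is uniformly close on \<open>K\<close> to a simple function. This replaces
  separability of the range.\<close>

lemma has_norm_integral_dominated:
  fixes f :: "'x::t2_space \<Rightarrow> 'c::{banach, second_countable_topology}" and h :: "'x \<Rightarrow> 'b::banach"
  assumes \<mu>: "regular_borel_measure \<mu>" and f: "continuous_on UNIV f" "integrable \<mu> f"
    and h: "continuous_on UNIV h" and C: "0 \<le> C" "\<And>t. norm (h t) \<le> C * norm (f t)"
  shows "\<exists>x. has_norm_integral \<mu> h x"
proof (rule has_norm_integral_exists)
  have sets[measurable_cong]: "sets \<mu> = sets borel" by (rule regular_borel_measureD[OF \<mu>])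
  have [measurable]: "f \<in> borel_measurable \<mu>" using f(2) by auto
  show hm: "h \<in> borel_measurable \<mu>"
    using borel_measurable_continuous_onI[OF h] by (simp add: measurable_cong_sets[OF sets refl])
  fix e :: real assume e: "0 < e"
  have "0 < e / (2 * (C + 1))" using e C(1) by simp
  from integral_concentrated_on_compact[OF \<mu> f this]
  obtain K where K: "compact K" "(\<integral>\<^sup>+t\<in>-K. norm (f t) \<partial>\<mu>) \<le> ennreal (e / (2 * (C + 1)))" by blast
  have [measurable]: "K \<in> sets \<mu>" using K(1) by (simp add: sets borel_closed compact_imp_closed)
  have Kfin: "emeasure \<mu> K < \<infinity>" by (rule regular_borel_measureD(2)[OF \<mu> K(1)])
  define \<eta> where "\<eta> = e / (2 * (measure \<mu> K + 1))"
  have \<eta>: "0 < \<eta>" using e by (simp add: \<eta>_def add_nonneg_pos)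
  have "compact (h ` K)"
    using K(1) h by (intro compact_continuous_image) (auto intro: continuous_on_subset)
  then obtain F where F: "finite F" "h ` K \<subseteq> (\<Union>x\<in>F. ball x \<eta>)"
    using \<eta> by (auto simp: compact_eq_totally_bounded)
  have "\<exists>c\<in>F. norm (h t - c) < \<eta>" if "t \<in> K" for t
    using F(2) that by (force simp: dist_norm norm_minus_commute)
  from simple_approximation_finite_range[OF F(1) hm \<open>K \<in> sets \<mu>\<close> Kfin this]
  obtain s where s: "integrable_simple \<mu> s" "\<forall>t\<in>K. norm (h t - s t) < \<eta>" "\<forall>t. t \<notin> K \<longrightarrow> s t = 0"
    by blast
  have "(\<integral>\<^sup>+t. norm (h t - s t) \<partial>\<mu>) \<le>
      (\<integral>\<^sup>+t. ennreal \<eta> * indicator K t + ennreal C * (ennreal (norm (f t)) * indicator (- K) t) \<partial>\<mu>)"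
    using s(2,3) C by (intro nn_integral_mono)
      (auto simp: indicator_def less_imp_le simp flip: ennreal_mult intro!: ennreal_leI)
  also have "\<dots> = ennreal \<eta> * emeasure \<mu> K + ennreal C * (\<integral>\<^sup>+t\<in>-K. norm (f t) \<partial>\<mu>)"
    by (subst nn_integral_add) (auto simp: nn_integral_cmult nn_integral_cmult_indicator)
  also have "\<dots> \<le> ennreal \<eta> * ennreal (measure \<mu> K) + ennreal C * ennreal (e / (2 * (C + 1)))"
    using K(2) Kfin by (intro add_mono mult_left_mono) (auto simp: emeasure_eq_ennreal_measure)
  also have "\<dots> = ennreal (\<eta> * measure \<mu> K + C * (e / (2 * (C + 1))))"
    using C(1) less_imp_le[OF \<eta>] less_imp_le[OF \<open>0 < e / (2 * (C + 1))\<close>]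
    by (simp only: ennreal_mult ennreal_plus measure_nonneg mult_nonneg_nonneg)
  also have "\<dots> \<le> ennreal (e / 2 + e / 2)"
  proof (intro ennreal_leI add_mono)
    have half: "r * (e / (2 * (r + 1))) \<le> e / 2" if "0 \<le> r" for r
    proof -
      have "r * (e / (2 * (r + 1))) \<le> (r + 1) * (e / (2 * (r + 1)))"
        using that e by (intro mult_right_mono) auto
      also have "\<dots> = e / 2" using that by (simp add: divide_simps algebra_simps)
      finally show ?thesis .
    qed
    show "\<eta> * measure \<mu> K \<le> e / 2"
      using half[of "measure \<mu> K"] by (simp add: \<eta>_def mult.commute)
    show "C * (e / (2 * (C + 1))) \<le> e / 2"
      by (rule half[OF C(1)])
  qed
  finally show "\<exists>s. integrable_simple \<mu> s \<and> (\<integral>\<^sup>+t. norm (h t - s t) \<partial>\<mu>) \<le> ennreal e"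
    using s(1) by auto
qed


section \<open>Averages over the action\<close>

lemma bounded_bilinear_scaleC: "bounded_bilinear ((*\<^sub>C) :: complex \<Rightarrow> 'a::cstar_algebra \<Rightarrow> 'a)"
proof
  show "\<exists>K. \<forall>c (x :: 'a). norm (c *\<^sub>C x) \<le> norm c * norm x * K"
    by (rule exI[of _ 1]) (simp add: norm_scaleC)
qed (simp_all add: scaleC_add_left scaleC_add_right scaleR_scaleC scaleC_scaleC scaleR_conv_of_real mult.commute)

lemma norm_continuous_actionD:
  assumes "norm_continuous_action \<alpha>"
  shows "star_automorphism (\<alpha> t)" "continuous_on UNIV (\<lambda>t. \<alpha> t a)"
    "\<alpha> t (\<alpha> (- t) b) = b" "inv (\<alpha> t) = \<alpha> (- t)"
proof -
  have au: "star_automorphism (\<alpha> t)" for t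
    using assms by (simp add: norm_continuous_action_def)
  show "star_automorphism (\<alpha> t)" by (rule au)
  show "continuous_on UNIV (\<lambda>t. \<alpha> t a)"
    using assms by (simp add: norm_continuous_action_def)
  have add: "\<alpha> (s + t) b = \<alpha> s (\<alpha> t b)" for s t b
    using assms by (simp add: norm_continuous_action_def)
  have bij: "bij (\<alpha> t)" for t by (rule star_automorphism_rules(6)[OF au])
  have 0: "\<alpha> 0 b = b" for b
    using add[of 0 0 b] bij[of 0] by (simp add: bij_is_inj inj_eq)
  have inverse: "\<alpha> t (\<alpha> (- t) b) = b" for b
    using add[of t "- t" b] by (simp add: 0)
  then show "\<alpha> t (\<alpha> (- t) b) = b" .
  show "inv (\<alpha> t) = \<alpha> (- t)"
    using bij[of t] by (intro ext) (metis inverse bij_is_inj inv_f_f)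
qed

lemma norm_action:
  assumes "norm_continuous_action \<alpha>"
  shows "norm (\<alpha> t b) = norm b"
proof (rule antisym)
  have "norm b = norm (inv (\<alpha> t) (\<alpha> t b))"
    using star_automorphism_rules(6)[OF norm_continuous_actionD(1)[OF assms]] by (simp add: bij_is_inj)
  also have "\<dots> \<le> norm (\<alpha> t b)"
    by (intro norm_star_automorphism_le star_automorphism_inv norm_continuous_actionD[OF assms])
  finally show "norm b \<le> norm (\<alpha> t b)" .
qed (rule norm_star_automorphism_le[OF norm_continuous_actionD(1)[OF assms]])

text \<open>Isometry of the automorphisms upgrades continuity of each orbit to joint continuity along a
  continuous curve.\<close>

lemma continuous_on_action:
  assumes \<alpha>: "norm_continuous_action \<alpha>" and v: "continuous_on UNIV v"
  shows "continuous_on UNIV (\<lambda>t. \<alpha> t (v t))"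
  unfolding continuous_on_def
proof (intro ballI)
  fix t
  have "((\<lambda>s. \<alpha> s (v t)) \<longlongrightarrow> \<alpha> t (v t)) (at t)"
    using norm_continuous_actionD(2)[OF \<alpha>] by (simp add: continuous_on_def)
  moreover have "((\<lambda>s. v s - v t) \<longlongrightarrow> 0) (at t)"
    using v by (simp add: continuous_on_def Lim_null[of v])
  then have "((\<lambda>s. \<alpha> s (v s - v t)) \<longlongrightarrow> 0) (at t)"
    by (rule tendsto_norm_zero_cancel[OF Lim_transform_eventually[OF tendsto_norm_zero]])
      (simp add: norm_action[OF \<alpha>])
  ultimately have "((\<lambda>s. \<alpha> s (v s - v t) + \<alpha> s (v t)) \<longlongrightarrow> 0 + \<alpha> t (v t)) (at t)"
    by (rule tendsto_add[rotated])
  then show "((\<lambda>s. \<alpha> s (v s)) \<longlongrightarrow> \<alpha> t (v t)) (at t within UNIV)"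
    by (simp flip: star_automorphism_rules(1)[OF norm_continuous_actionD(1)[OF \<alpha>]])
qed

lemma continuous_on_conjugate:
  assumes \<alpha>: "norm_continuous_action \<alpha>" and T: "bounded_linear T"
  shows "continuous_on UNIV (\<lambda>t. \<alpha> t (T (\<alpha> (- t) b)))"
proof (rule continuous_on_action[OF \<alpha>])
  have "continuous_on UNIV (\<lambda>t. \<alpha> (- t) b)"
    using continuous_on_compose2[OF norm_continuous_actionD(2)[OF \<alpha>, of b] continuous_on_minus[OF continuous_on_id]]
    by simp
  then show "continuous_on UNIV (\<lambda>t. T (\<alpha> (- t) b))"
    by (rule bounded_linear.continuous_on[OF T])
qed

text \<open>The average over the group of the conjugates \<open>\<alpha>\<^sub>t \<circ> T \<circ> \<alpha>\<^bsub>-t\<^esub>\<close>, weighted by \<open>f\<close> and evaluated at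
  \<open>b\<close>. A general operator \<open>T\<close> lets left and right multiplications by multipliers be treated
  together.\<close>

definition has_average ::
  "('g::group_add \<Rightarrow> 'a::cstar_algebra \<Rightarrow> 'a) \<Rightarrow> 'g measure \<Rightarrow> ('g \<Rightarrow> complex) \<Rightarrow> ('a \<Rightarrow> 'a) \<Rightarrow> 'a \<Rightarrow> 'a \<Rightarrow> bool"
where
  "has_average \<alpha> \<mu> f T b y \<longleftrightarrow> has_norm_integral \<mu> (\<lambda>t. f t *\<^sub>C \<alpha> t (T (\<alpha> (- t) b))) y"

context
  fixes \<alpha> :: "'g::{topological_group_add, t2_space} \<Rightarrow> 'a::cstar_algebra \<Rightarrow> 'a"
    and \<mu> :: "'g measure" and f :: "'g \<Rightarrow> complex"
  assumes \<mu>: "regular_borel_measure \<mu>" and \<alpha>: "norm_continuous_action \<alpha>"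
    and f: "continuous_on UNIV f" "integrable \<mu> f"
begin

lemma borel_measurable_average:
  assumes "bounded_linear T"
  shows "(\<lambda>t. f t *\<^sub>C \<alpha> t (T (\<alpha> (- t) b))) \<in> borel_measurable \<mu>"
  using borel_measurable_continuous_onI[OF bounded_bilinear.continuous_on[OF bounded_bilinear_scaleC f(1)
      continuous_on_conjugate[OF \<alpha> assms]]]
  by (simp add: measurable_cong_sets[OF regular_borel_measureD(1)[OF \<mu>] refl])

lemma norm_average_integrand_le:
  assumes "norm (T (\<alpha> (- t) b)) \<le> C * norm b"
  shows "norm (f t *\<^sub>C \<alpha> t (T (\<alpha> (- t) b))) \<le> (C * norm b) * norm (f t)"
  using mult_left_mono[OF assms, of "norm (f t)"] by (simp add: norm_scaleC norm_action[OF \<alpha>] mult_ac)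

lemma has_average_exists:
  assumes T: "bounded_linear T"
  shows "\<exists>y. has_average \<alpha> \<mu> f T b y"
proof -
  obtain C where C: "0 \<le> C" "\<And>v. norm (T v) \<le> C * norm v"
    using bounded_linear.nonneg_bounded[OF T] by (metis mult.commute)
  have "norm (T (\<alpha> (- t) b)) \<le> C * norm b" for t
    using C(2)[of "\<alpha> (- t) b"] by (simp add: norm_action[OF \<alpha>])
  then show ?thesis
    unfolding has_average_def using C(1)
    by (intro has_norm_integral_dominated[OF \<mu> f, where C = "C * norm b"]
        bounded_bilinear.continuous_on[OF bounded_bilinear_scaleC f(1) continuous_on_conjugate[OF \<alpha> T]]
        norm_average_integrand_le) simp_all
qed

lemma has_average_unique:
  "has_average \<alpha> \<mu> f T b y \<Longrightarrow> has_average \<alpha> \<mu> f T b z \<Longrightarrow> y = z"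
  unfolding has_average_def by (rule has_norm_integral_unique)

lemma has_average_norm_le:
  assumes y: "has_average \<alpha> \<mu> f T b y" and C: "0 \<le> C" "\<And>v. norm (T v) \<le> C * norm v"
  shows "norm y \<le> (LINT t|\<mu>. norm (f t)) * C * norm b"
proof -
  have le: "norm (f t *\<^sub>C \<alpha> t (T (\<alpha> (- t) b))) \<le> (C * norm b) * norm (f t)" for t
    using C(2)[of "\<alpha> (- t) b"] by (intro norm_average_integrand_le) (simp add: norm_action[OF \<alpha>])
  have fm: "f \<in> borel_measurable \<mu>" using f(2) by auto
  have "ennreal (norm y) \<le> (\<integral>\<^sup>+t. norm (f t *\<^sub>C \<alpha> t (T (\<alpha> (- t) b))) \<partial>\<mu>)"
    using y unfolding has_average_def by (rule has_norm_integral_norm_le)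
  also have "\<dots> \<le> (\<integral>\<^sup>+t. ennreal (C * norm b) * ennreal (norm (f t)) \<partial>\<mu>)"
    using le C(1) by (intro nn_integral_mono) (simp add: ennreal_leI flip: ennreal_mult)
  also have "\<dots> = ennreal (C * norm b) * ennreal (LINT t|\<mu>. norm (f t))"
    using fm f(2) by (simp add: nn_integral_cmult nn_integral_eq_integral)
  also have "\<dots> = ennreal ((LINT t|\<mu>. norm (f t)) * C * norm b)"
    using C(1) by (simp add: mult_ac flip: ennreal_mult)
  finally show ?thesis
    using C(1) by (subst (asm) ennreal_le_iff) auto
qed

text \<open>One rule serves for sums of operators at one point and for one operator at a sum of points.\<close>

lemma has_average_add:
  assumes T: "bounded_linear T" "bounded_linear S"
    and y: "has_average \<alpha> \<mu> f T b y" "has_average \<alpha> \<mu> f S c z"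
    and sum: "\<And>t. T (\<alpha> (- t) b) + S (\<alpha> (- t) c) = R (\<alpha> (- t) d)" and R: "bounded_linear R"
  shows "has_average \<alpha> \<mu> f R d (y + z)"
proof -
  have eq: "(\<lambda>t. f t *\<^sub>C \<alpha> t (T (\<alpha> (- t) b)) + f t *\<^sub>C \<alpha> t (S (\<alpha> (- t) c))) =
      (\<lambda>t. f t *\<^sub>C \<alpha> t (R (\<alpha> (- t) d)))"
    by (simp add: star_automorphism_rules(1)[OF norm_continuous_actionD(1)[OF \<alpha>]] flip: sum scaleC_add_right)
  show ?thesis
    using has_norm_integral_add[OF y[unfolded has_average_def]] borel_measurable_average[OF R, of d]
    by (simp add: eq has_average_def)
qed

text \<open>On a compact \<open>K\<close> carrying most of \<open>|f|\<close> the operators are small along the orbit of \<open>b\<close>: they are small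
  on a finite net of the compact orbit by pointwise convergence, and near the net by the uniform bound
  \<open>D\<close>. Off \<open>K\<close> the bound \<open>D \<parallel>b\<parallel>\<close> suffices.\<close>

lemma has_average_tendsto_0:
  assumes T: "\<And>i. bounded_linear (T i)" and lim: "\<And>v. ((\<lambda>i. T i v) \<longlongrightarrow> 0) F"
    and D: "0 \<le> D" "\<forall>\<^sub>F i in F. \<forall>v. norm (T i v) \<le> D * norm v"
    and y: "\<And>i. has_average \<alpha> \<mu> f (T i) b (y i)"
  shows "(y \<longlongrightarrow> 0) F"
proof (rule tendstoI)
  fix e :: real assume e: "0 < e"
  define J where "J = (LINT t|\<mu>. norm (f t))"
  have J: "0 \<le> J" by (simp add: J_def)
  have fm[measurable]: "f \<in> borel_measurable \<mu>" using f(2) by auto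
  have nnJ: "(\<integral>\<^sup>+t. norm (f t) \<partial>\<mu>) = ennreal J"
    using f(2) by (simp add: J_def nn_integral_eq_integral)
  define r where "r = e / 3 / (D * norm b + 1)"
  have Db: "0 \<le> D * norm b" using D(1) by simp
  have r: "0 < r" using e Db by (simp add: r_def)
  obtain K where K: "compact K" "(\<integral>\<^sup>+t\<in>-K. norm (f t) \<partial>\<mu>) \<le> ennreal r"
    using integral_concentrated_on_compact[OF \<mu> f r] by blast
  have [measurable]: "K \<in> sets \<mu>"
    using K(1) by (simp add: regular_borel_measureD(1)[OF \<mu>] borel_closed compact_imp_closed)
  define \<eta> where "\<eta> = e / 3 / (1 + D) / (J + 1)"
  have \<eta>: "0 < \<eta>" using e D(1) J by (simp add: \<eta>_def)
  have "compact ((\<lambda>t. \<alpha> (- t) b) ` K)"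
    using K(1) continuous_on_compose2[OF norm_continuous_actionD(2)[OF \<alpha>, of b] continuous_on_minus[OF continuous_on_id]]
    by (intro compact_continuous_image) (auto intro: continuous_on_subset)
  then obtain B where B: "finite B" "(\<lambda>t. \<alpha> (- t) b) ` K \<subseteq> (\<Union>c\<in>B. ball c \<eta>)"
    using \<eta> by (auto simp: compact_eq_totally_bounded)
  have "\<forall>\<^sub>F i in F. \<forall>c\<in>B. norm (T i c) < \<eta>"
    using lim \<eta> B(1) by (simp add: eventually_ball_finite_distrib tendsto_iff)
  with D(2) show "\<forall>\<^sub>F i in F. dist (y i) 0 < e"
  proof eventually_elim
    case (elim i)
    interpret Ti: bounded_linear "T i" by (rule T)
    \<comment> \<open>Compare with the nearest point \<open>c\<close> of the finite net \<open>B\<close>.\<close>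
    have on_K: "norm (T i (\<alpha> (- t) b)) \<le> (1 + D) * \<eta>" if "t \<in> K" for t
    proof -
      obtain c where c: "c \<in> B" "dist c (\<alpha> (- t) b) < \<eta>" using B(2) \<open>t \<in> K\<close> by auto
      have "norm (T i (\<alpha> (- t) b)) \<le> norm (T i c) + norm (T i (\<alpha> (- t) b - c))"
        using norm_triangle_ineq[of "T i c" "T i (\<alpha> (- t) b - c)"] by (simp add: Ti.diff)
      also have "\<dots> \<le> \<eta> + D * \<eta>"
      proof (rule add_mono)
        show "norm (T i c) \<le> \<eta>" using elim(2) c(1) by (simp add: less_imp_le)
        have "norm (T i (\<alpha> (- t) b - c)) \<le> D * norm (\<alpha> (- t) b - c)" using elim(1) by blast
        also have "\<dots> \<le> D * \<eta>"
          using c(2) D(1) by (intro mult_left_mono) (simp_all add: dist_norm norm_minus_commute)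
        finally show "norm (T i (\<alpha> (- t) b - c)) \<le> D * \<eta>" .
      qed
      finally show ?thesis by (simp add: algebra_simps)
    qed
    have off_K: "norm (T i (\<alpha> (- t) b)) \<le> D * norm b" for t
      using elim(1)[rule_format, of "\<alpha> (- t) b"] by (simp add: norm_action[OF \<alpha>])
    have p: "0 \<le> (1 + D) * \<eta>" using \<eta> D(1) by simp
    have "ennreal (norm (y i)) \<le> (\<integral>\<^sup>+t. norm (f t *\<^sub>C \<alpha> t (T i (\<alpha> (- t) b))) \<partial>\<mu>)"
      using y[of i] unfolding has_average_def by (rule has_norm_integral_norm_le)
    also have "\<dots> \<le> (\<integral>\<^sup>+t. ennreal ((1 + D) * \<eta>) * ennreal (norm (f t)) +
        ennreal (D * norm b) * (ennreal (norm (f t)) * indicator (- K) t) \<partial>\<mu>)"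
    proof (intro nn_integral_mono)
      fix t
      show "ennreal (norm (f t *\<^sub>C \<alpha> t (T i (\<alpha> (- t) b)))) \<le> ennreal ((1 + D) * \<eta>) * ennreal (norm (f t)) +
          ennreal (D * norm b) * (ennreal (norm (f t)) * indicator (- K) t)"
      proof (cases "t \<in> K")
        case True
        then show ?thesis
          using mult_left_mono[OF on_K[OF True], of "norm (f t)"] p
          by (simp add: norm_scaleC norm_action[OF \<alpha>] mult.commute ennreal_leI flip: ennreal_mult)
      next
        case False
        have "ennreal (norm (f t *\<^sub>C \<alpha> t (T i (\<alpha> (- t) b)))) \<le> ennreal (D * norm b) * ennreal (norm (f t))"
          using mult_left_mono[OF off_K, of "norm (f t)"] Db
          by (simp add: norm_scaleC norm_action[OF \<alpha>] mult.commute ennreal_leI flip: ennreal_mult)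
        then show ?thesis using False by (simp add: add_increasing)
      qed
    qed
    also have "\<dots> = ennreal ((1 + D) * \<eta>) * ennreal J + ennreal (D * norm b) * (\<integral>\<^sup>+t\<in>-K. norm (f t) \<partial>\<mu>)"
      by (subst nn_integral_add) (simp_all add: nn_integral_cmult nnJ)
    also have "\<dots> \<le> ennreal ((1 + D) * \<eta>) * ennreal J + ennreal (D * norm b) * ennreal r"
      using K(2) by (intro add_left_mono mult_left_mono) auto
    also have "\<dots> = ennreal ((1 + D) * \<eta> * J + D * norm b * r)"
      using p J Db less_imp_le[OF r]
      by (simp only: ennreal_mult ennreal_plus mult_nonneg_nonneg)
    finally have "norm (y i) \<le> (1 + D) * \<eta> * J + D * norm b * r"
      using p J Db r by (subst (asm) ennreal_le_iff) auto
    also have "\<dots> \<le> e / 3 + e / 3"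
    proof (rule add_mono)
      have nz: "1 + D \<noteq> 0" "J + 1 \<noteq> 0" "D * norm b + 1 \<noteq> 0" using D(1) J Db by linarith+
      have cancel: "u * (e / 3 / u / w) * w = e / 3" if "u \<noteq> 0" "w \<noteq> 0" for u w
        using that by simp
      have "(1 + D) * \<eta> * J \<le> (1 + D) * \<eta> * (J + 1)" using p by (intro mult_left_mono) auto
      also have "\<dots> = e / 3" unfolding \<eta>_def by (rule cancel[OF nz(1,2)])
      finally show "(1 + D) * \<eta> * J \<le> e / 3" .
      have "D * norm b * r \<le> (D * norm b + 1) * r" using r by (intro mult_right_mono) auto
      also have "\<dots> = e / 3" using cancel[OF nz(3) one_neq_zero] unfolding r_def by (simp only: div_by_1 mult_1_right)
      finally show "D * norm b * r \<le> e / 3" .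
    qed
    also have "\<dots> < e" using e by simp
    finally show ?case by simp
  qed
qed

lemma has_average_tendsto:
  assumes T: "\<And>i. bounded_linear (T i)" "bounded_linear S" and lim: "\<And>v. ((\<lambda>i. T i v) \<longlongrightarrow> S v) F"
    and D: "0 \<le> D" "\<forall>\<^sub>F i in F. \<forall>v. norm (T i v) \<le> D * norm v"
    and y: "\<And>i. has_average \<alpha> \<mu> f (T i) b (y i)" and z: "has_average \<alpha> \<mu> f S b z"
  shows "(y \<longlongrightarrow> z) F"
proof -
  obtain C where C: "0 \<le> C" "\<And>v. norm (S v) \<le> C * norm v"
    using bounded_linear.nonneg_bounded[OF T(2)] by (metis mult.commute)
  have nS: "bounded_linear (\<lambda>v. - S v)" by (rule bounded_linear_minus[OF T(2)])
  have d: "bounded_linear (\<lambda>v. T i v - S v)" for i by (rule bounded_linear_sub[OF T(1) T(2)])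
  have z': "has_average \<alpha> \<mu> f (\<lambda>v. - S v) b (- z)"
  proof -
    have neg: "\<alpha> t (- v) = - \<alpha> t v" for t v
      using bounded_linear.linear[OF bounded_linear_star_automorphism[OF norm_continuous_actionD(1)[OF \<alpha>]]]
      by (rule linear_neg)
    have "f t *\<^sub>C - v = - (f t *\<^sub>C v)" for t and v :: 'a
      by (rule bounded_bilinear.minus_right[OF bounded_bilinear_scaleC])
    with has_norm_integral_bounded_linear[OF bounded_linear_minus[OF bounded_linear_ident] z[unfolded has_average_def]]
    show ?thesis by (simp add: has_average_def neg)
  qed
  have "has_average \<alpha> \<mu> f (\<lambda>v. T i v - S v) b (y i + - z)" for i
    by (rule has_average_add[OF T(1) nS y z' _ d]) simp
  then have avg: "has_average \<alpha> \<mu> f (\<lambda>v. T i v - S v) b (y i - z)" for i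
    by simp
  have bound: "\<forall>\<^sub>F i in F. \<forall>v. norm (T i v - S v) \<le> (D + C) * norm v"
    using D(2)
  proof eventually_elim
    case (elim i)
    show ?case
    proof
      fix v
      have "norm (T i v - S v) \<le> norm (T i v) + norm (S v)" by (rule norm_triangle_ineq4)
      also have "\<dots> \<le> D * norm v + C * norm v" using elim C(2) by (intro add_mono) blast+
      finally show "norm (T i v - S v) \<le> (D + C) * norm v" by (simp add: distrib_right)
    qed
  qed
  have "((\<lambda>i. T i v - S v) \<longlongrightarrow> 0) F" for v
    using lim[of v] by (rule LIM_zero)
  then have "((\<lambda>i. y i - z) \<longlongrightarrow> 0) F"
    by (rule has_average_tendsto_0[OF d _ _ bound avg]) (simp add: D(1) C(1))
  then show ?thesis by (rule LIM_zero_cancel)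
qed

section \<open>The strict integral\<close>

lemma strict_integrand:
  "(f t *\<^sub>C strict_extension (\<alpha> t) m) \<cdot>\<^sub>L b = f t *\<^sub>C \<alpha> t (m \<cdot>\<^sub>L \<alpha> (- t) b)"
  "b \<cdot>\<^sub>R (f t *\<^sub>C strict_extension (\<alpha> t) m) = f t *\<^sub>C \<alpha> t (\<alpha> (- t) b \<cdot>\<^sub>R m)"
  by (simp_all add: multiplier_scaleC strict_extension_apply norm_continuous_actionD[OF \<alpha>])

lemma has_strict_integral_iff:
  "has_strict_integral \<mu> (\<lambda>t. f t *\<^sub>C strict_extension (\<alpha> t) m) n \<longleftrightarrow>
    (\<forall>b. has_average \<alpha> \<mu> f ((\<cdot>\<^sub>L) m) b (n \<cdot>\<^sub>L b) \<and> has_average \<alpha> \<mu> f (\<lambda>v. v \<cdot>\<^sub>R m) b (b \<cdot>\<^sub>R n))"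
  by (simp add: has_strict_integral_def strict_integrand has_average_def)

text \<open>The averages of left and right multiplication by \<open>m\<close> form a double centralizer. Each identity to be
  checked equates two norm integrals whose integrands are related by a bounded linear map, because
  \<open>\<alpha>\<^sub>t \<circ> m \<circ> \<alpha>\<^bsub>-t\<^esub>\<close> has the corresponding property for every \<open>t\<close>.\<close>

lemma has_strict_integral_exists:
  "\<exists>n. has_strict_integral \<mu> (\<lambda>t. f t *\<^sub>C strict_extension (\<alpha> t) m) n"
proof -
  note r = star_automorphism_rules[OF norm_continuous_actionD(1)[OF \<alpha>]]
  note inverse = norm_continuous_actionD(3)[OF \<alpha>]
  note bl = bounded_linear_multiplier_left[of m] and br = bounded_linear_multiplier_right[of m]
  obtain L where L: "\<And>b. has_average \<alpha> \<mu> f ((\<cdot>\<^sub>L) m) b (L b)"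
    using has_average_exists[OF bl] by metis
  obtain R where R: "\<And>b. has_average \<alpha> \<mu> f (\<lambda>v. v \<cdot>\<^sub>R m) b (R b)"
    using has_average_exists[OF br] by metis
  have transform: "T (y b) = z c"
    if T: "bounded_linear T" and y: "has_average \<alpha> \<mu> f S b (y b)" and z: "has_average \<alpha> \<mu> f S' c (z c)"
      and eq: "\<And>t. T (f t *\<^sub>C \<alpha> t (S (\<alpha> (- t) b))) = f t *\<^sub>C \<alpha> t (S' (\<alpha> (- t) c))"
    for T S S' b c and y z :: "'a \<Rightarrow> 'a"
    using has_norm_integral_bounded_linear[OF T y[unfolded has_average_def]] z
    by (simp add: eq has_average_def has_norm_integral_unique)
  have scC: "L (c *\<^sub>C b) = c *\<^sub>C L b" "R (c *\<^sub>C b) = c *\<^sub>C R b" for c b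
    by (rule transform[OF bounded_linear_scaleC L L, symmetric] transform[OF bounded_linear_scaleC R R, symmetric];
        simp add: r multiplier_rules scaleC_scaleC mult.commute)+
  have mult: "L (a * b) = L a * b" "R (a * b) = a * R b" for a b
    by (rule transform[OF bounded_linear_mult_left L L, symmetric] transform[OF bounded_linear_mult_right R R, symmetric];
        simp add: r multiplier_rules inverse mult_scaleC_left mult_scaleC_right)+
  have adj: "R a * b = a * L b" for a b
  proof -
    define h where "h = (\<lambda>t. f t *\<^sub>C (\<alpha> t (\<alpha> (- t) a \<cdot>\<^sub>R m) * b))"
    have "has_norm_integral \<mu> h (R a * b)"
      using has_norm_integral_bounded_linear[OF bounded_linear_mult_left[of b] R[of a, unfolded has_average_def]]
      by (simp add: h_def mult_scaleC_left)
    moreover have "\<alpha> t (\<alpha> (- t) a \<cdot>\<^sub>R m) * b = a * \<alpha> t (m \<cdot>\<^sub>L \<alpha> (- t) b)" for t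
      by (metis inverse mult_right_left r(4))
    then have "has_norm_integral \<mu> h (a * L b)"
      using has_norm_integral_bounded_linear[OF bounded_linear_mult_right[of a] L[of b, unfolded has_average_def]]
      by (simp add: h_def mult_scaleC_right)
    ultimately show ?thesis by (rule has_norm_integral_unique)
  qed
  have lin: "bounded_linear y"
    if T: "bounded_linear T" and y: "\<And>b. has_average \<alpha> \<mu> f T b (y b)"
      and scale: "\<And>c b. y (c *\<^sub>C b) = c *\<^sub>C y b" for T y
  proof -
    interpret T: bounded_linear T by (rule T)
    obtain C where C: "0 \<le> C" "\<And>v. norm (T v) \<le> C * norm v"
      using T.nonneg_bounded by (metis mult.commute)
    show ?thesis
    proof (rule bounded_linear_intro)
      show "y (b + c) = y b + y c" for b c
        by (rule has_average_unique[OF y has_average_add[OF T T y y _ T]]) (simp add: r T.add)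
      show "y (s *\<^sub>R b) = s *\<^sub>R y b" for s b by (simp add: scaleR_scaleC scale)
      show "norm (y b) \<le> norm b * ((LINT t|\<mu>. norm (f t)) * C)" for b
        using has_average_norm_le[OF y C] by (simp add: mult_ac)
    qed
  qed
  have "make_multiplier L R \<cdot>\<^sub>L b = L b" "b \<cdot>\<^sub>R make_multiplier L R = R b" for b
    by (rule make_multiplier[OF lin[OF bl L scC(1)] lin[OF br R scC(2)] scC mult adj])+
  then show ?thesis
    using L R by (intro exI[of _ "make_multiplier L R"]) (simp add: has_strict_integral_iff)
qed

lemma has_strict_integral_strict_integral:
  "has_strict_integral \<mu> (\<lambda>t. f t *\<^sub>C strict_extension (\<alpha> t) m)
    (strict_integral \<mu> (\<lambda>t. f t *\<^sub>C strict_extension (\<alpha> t) m))"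
proof -
  obtain n where n: "has_strict_integral \<mu> (\<lambda>t. f t *\<^sub>C strict_extension (\<alpha> t) m) n"
    using has_strict_integral_exists by blast
  show ?thesis
    unfolding strict_integral_def
  proof (rule theI[of _ n])
    fix k assume "has_strict_integral \<mu> (\<lambda>t. f t *\<^sub>C strict_extension (\<alpha> t) m) k"
    with n show "k = n"
      unfolding has_strict_integral_iff by (blast intro: multiplier_eqI has_average_unique)
  qed (rule n)
qed

lemma norm_strict_integral_le:
  "norm (strict_integral \<mu> (\<lambda>t. f t *\<^sub>C strict_extension (\<alpha> t) m)) \<le> (LINT t|\<mu>. norm (f t)) * norm m"
proof (rule norm_multiplier_le)
  fix b
  show "norm (strict_integral \<mu> (\<lambda>t. f t *\<^sub>C strict_extension (\<alpha> t) m) \<cdot>\<^sub>L b) \<le>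
      (LINT t|\<mu>. norm (f t)) * norm m * norm b"
    using has_strict_integral_strict_integral[of m] unfolding has_strict_integral_iff
    by (blast intro: has_average_norm_le norm_ge_zero norm_multiplier_left)
qed simp

text \<open>Strict convergence is pointwise convergence of the left and right multiplications, and so the
  convergence of averages applies to both.\<close>

lemma limitin_strict_integral:
  assumes lim: "limitin strict_topology x a F" and D: "\<forall>\<^sub>F i in F. norm (x i) \<le> D"
  shows "limitin strict_topology (\<lambda>i. strict_integral \<mu> (\<lambda>t. f t *\<^sub>C strict_extension (\<alpha> t) (x i)))
    (strict_integral \<mu> (\<lambda>t. f t *\<^sub>C strict_extension (\<alpha> t) a)) F"
  unfolding limitin_strict_iff
proof (intro allI conjI)
  note avg = has_strict_integral_strict_integral[unfolded has_strict_integral_iff, rule_format]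
  have mono: "norm m * norm v \<le> max D 0 * norm v" if "norm m \<le> D" for m :: "'a multiplier" and v :: 'a
    using that by (intro mult_right_mono) auto
  fix b
  show "((\<lambda>i. strict_integral \<mu> (\<lambda>t. f t *\<^sub>C strict_extension (\<alpha> t) (x i)) \<cdot>\<^sub>L b) \<longlongrightarrow>
      strict_integral \<mu> (\<lambda>t. f t *\<^sub>C strict_extension (\<alpha> t) a) \<cdot>\<^sub>L b) F"
  proof (rule has_average_tendsto[OF bounded_linear_multiplier_left bounded_linear_multiplier_left])
    show "((\<lambda>i. x i \<cdot>\<^sub>L v) \<longlongrightarrow> a \<cdot>\<^sub>L v) F" for v using lim by (simp add: limitin_strict_iff)
    show "\<forall>\<^sub>F i in F. \<forall>v. norm (x i \<cdot>\<^sub>L v) \<le> max D 0 * norm v"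
      using D by eventually_elim (blast intro: order_trans norm_multiplier_left mono)
  qed (simp, rule conjunct1[OF avg], rule conjunct1[OF avg])
  show "((\<lambda>i. b \<cdot>\<^sub>R strict_integral \<mu> (\<lambda>t. f t *\<^sub>C strict_extension (\<alpha> t) (x i))) \<longlongrightarrow>
      b \<cdot>\<^sub>R strict_integral \<mu> (\<lambda>t. f t *\<^sub>C strict_extension (\<alpha> t) a)) F"
  proof (rule has_average_tendsto[OF bounded_linear_multiplier_right bounded_linear_multiplier_right])
    show "((\<lambda>i. v \<cdot>\<^sub>R x i) \<longlongrightarrow> v \<cdot>\<^sub>R a) F" for v using lim by (simp add: limitin_strict_iff)
    show "\<forall>\<^sub>F i in F. \<forall>v. norm (v \<cdot>\<^sub>R x i) \<le> max D 0 * norm v"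
      using D by eventually_elim (blast intro: order_trans norm_multiplier_right mono)
  qed (simp, rule conjunct2[OF avg], rule conjunct2[OF avg])
qed

end

theorem mainTheorem5:
  fixes \<alpha> :: "'g::{topological_group_add, t2_space} \<Rightarrow> 'a::cstar_algebra \<Rightarrow> 'a"
    and \<mu> :: "'g measure"
    and f :: "'g \<Rightarrow> complex"
    and I :: "'i set" and le :: "'i \<Rightarrow> 'i \<Rightarrow> bool"
    and x :: "'i \<Rightarrow> 'a multiplier" and a :: "'a multiplier"
  assumes "locally_compact_space (euclidean :: 'g topology)"
    and "regular_borel_measure \<mu>"
    and "norm_continuous_action \<alpha>"
    and "continuous_on UNIV f" and "integrable \<mu> f"
    and "directed_set I le"
    and "bounded (x ` I)"
    and "limitin strict_topology x a (net_filter I le)"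
  shows "bounded ((\<lambda>i. strict_integral \<mu> (\<lambda>t. f t *\<^sub>C strict_extension (\<alpha> t) (x i))) ` I) \<and>
    limitin strict_topology
      (\<lambda>i. strict_integral \<mu> (\<lambda>t. f t *\<^sub>C strict_extension (\<alpha> t) (x i)))
      (strict_integral \<mu> (\<lambda>t. f t *\<^sub>C strict_extension (\<alpha> t) a))
      (net_filter I le)"
proof -
  obtain D where D: "\<And>i. i \<in> I \<Longrightarrow> norm (x i) \<le> D"
    using assms(7) by (auto simp: bounded_iff)
  note setting = assms(2,3,4,5)
  have "norm (strict_integral \<mu> (\<lambda>t. f t *\<^sub>C strict_extension (\<alpha> t) (x i))) \<le> (LINT t|\<mu>. norm (f t)) * D"
    if "i \<in> I" for i
    by (rule order_trans[OF norm_strict_integral_le[OF setting] mult_left_mono[OF D[OF that]]]) simp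
  then have "bounded ((\<lambda>i. strict_integral \<mu> (\<lambda>t. f t *\<^sub>C strict_extension (\<alpha> t) (x i))) ` I)"
    by (auto simp: bounded_iff)
  moreover have "\<forall>\<^sub>F i in net_filter I le. norm (x i) \<le> D"
    using assms(6) D by (auto simp: eventually_net_filter[OF assms(6)] directed_set_def)
  ultimately show ?thesis
    using limitin_strict_integral[OF setting assms(8)] by blast
qed

end
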